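(* Let $S$ be a finite symmetric generating set of $H_3(\mathbb{Z})$. There exist real constants $C,M>0$ and $D_0>0$ such that for all real $D\ge D_0$ and all integers $n\ge C\cdot D^4$, the element $g=[x,y]^n$ satisfies $$\|gh\|_S\le\|g\|_S+M\qquad\text{for all }h\in H_3(\mathbb{Z})\text{ such that }\|h\|_S\le D.$$
   Context: $H_3(\mathbb{Z})=\langle x,y\mid [x,y]\text{ central}\rangle$ is the discrete Heisenberg group, and $\|\cdot\|_S$ is the word length with respect to $S$. *)

theory Defs
  imports Complex_Main "HOL-Algebra.Generated_Groups"
begin

section \<open>The discrete Heisenberg group, by its presentation\<close>

datatype gen = Gen_x | Gen_y

text \<open>A letter is a generator together with a flag; the flag \<open>True\<close> marks the formal inverse.\<close>

type_synonym letter = "gen \<times> bool"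

definition inv_letter :: "letter \<Rightarrow> letter" where
  "inv_letter a = (fst a, \<not> snd a)"

definition inv_word :: "letter list \<Rightarrow> letter list" where
  "inv_word w = rev (map inv_letter w)"

definition comm_word :: "letter list" where
  "comm_word = (let u = [(Gen_x, False)]; v = [(Gen_y, False)] in u @ v @ inv_word u @ inv_word v)"

text \<open>The least congruence on the free monoid of words that makes formal inverses into inverses
  and the commutator \<open>[x,y]\<close> central.\<close>

inductive heis_eq :: "letter list \<Rightarrow> letter list \<Rightarrow> bool" where
  refl: "heis_eq u u"
| sym: "heis_eq u v \<Longrightarrow> heis_eq v u"
| trans: "heis_eq u v \<Longrightarrow> heis_eq v w \<Longrightarrow> heis_eq u w"
| append: "heis_eq u u' \<Longrightarrow> heis_eq v v' \<Longrightarrow> heis_eq (u @ v) (u' @ v')"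
| cancel: "heis_eq [a, inv_letter a] []"
| central: "heis_eq (comm_word @ w) (w @ comm_word)"

quotient_type heis = "letter list" / heis_eq
  by (intro equivpI reflpI sympI transpI) (blast intro: heis_eq.intros)+

lift_definition heis_one :: heis is "[]" .

lift_definition heis_mult :: "heis \<Rightarrow> heis \<Rightarrow> heis" is "(@)"
  by (rule heis_eq.append)

lift_definition heis_x :: heis is "[(Gen_x, False)]" .

lift_definition heis_y :: heis is "[(Gen_y, False)]" .

definition H3 :: "heis monoid" where
  "H3 = \<lparr>carrier = UNIV, monoid.mult = heis_mult, one = heis_one\<rparr>"

lemma heis_eq_inv_word: "heis_eq (inv_word w @ w) []"
proof (induction w)
  case Nil
  show ?case by (simp add: inv_word_def heis_eq.refl)
next
  case (Cons a w)
  have "inv_letter (inv_letter a) = a"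
    by (simp add: inv_letter_def)
  then have "heis_eq [inv_letter a, a] []"
    using heis_eq.cancel[of "inv_letter a"] by simp
  then have "heis_eq (inv_word w @ [inv_letter a, a] @ w) (inv_word w @ [] @ w)"
    by (intro heis_eq.append heis_eq.refl)
  then show ?case
    using Cons.IH heis_eq.trans by (fastforce simp: inv_word_def)
qed

lemma group_H3: "group H3"
proof (rule groupI)
  fix a assume "a \<in> carrier H3"
  have "\<exists>b. heis_mult b a = heis_one"
    by transfer (blast intro: heis_eq_inv_word)
  then show "\<exists>b\<in>carrier H3. b \<otimes>\<^bsub>H3\<^esub> a = \<one>\<^bsub>H3\<^esub>"
    by (simp add: H3_def)
next
  fix a b c
  have "heis_mult (heis_mult a b) c = heis_mult a (heis_mult b c)"
    by transfer (simp add: heis_eq.refl)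
  then show "a \<otimes>\<^bsub>H3\<^esub> b \<otimes>\<^bsub>H3\<^esub> c = a \<otimes>\<^bsub>H3\<^esub> (b \<otimes>\<^bsub>H3\<^esub> c)"
    by (simp add: H3_def)
next
  fix a
  have "heis_mult heis_one a = a"
    by transfer (simp add: heis_eq.refl)
  then show "\<one>\<^bsub>H3\<^esub> \<otimes>\<^bsub>H3\<^esub> a = a"
    by (simp add: H3_def)
qed (simp_all add: H3_def)

section \<open>Commutators and word length\<close>

definition commutator :: "('a, 'b) monoid_scheme \<Rightarrow> 'a \<Rightarrow> 'a \<Rightarrow> 'a" where
  "commutator G a b = a \<otimes>\<^bsub>G\<^esub> b \<otimes>\<^bsub>G\<^esub> inv\<^bsub>G\<^esub> a \<otimes>\<^bsub>G\<^esub> inv\<^bsub>G\<^esub> b"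

text \<open>Words are products of elements of \<open>S\<close> only, without inverses, so this is the usual word
  length when \<open>S\<close> is symmetric.  It is meaningful only on elements that \<open>S\<close> generates.\<close>

definition word_length :: "('a, 'b) monoid_scheme \<Rightarrow> 'a set \<Rightarrow> 'a \<Rightarrow> nat" where
  "word_length G S g =
     (LEAST k. \<exists>ws. set ws \<subseteq> S \<and> length ws = k \<and> foldr (\<otimes>\<^bsub>G\<^esub>) ws \<one>\<^bsub>G\<^esub> = g)"

end

theory Submission
  imports Defs "HOL-Analysis.Analysis"
begin

text \<open>An element of the Heisenberg group has two coordinates: its image \<open>v \<in> \<int>\<^sup>2\<close> in the
  abelianization, and a height \<open>t\<close>, which is twice the signed area between a path that spells the
  element and the chord of that path. Heights add up in products, except for the correction
  \<open>wedge v v'\<close>, and \<open>[x,y]\<^sup>n\<close> is \<open>(0, 2n)\<close>. A geodesic word for \<open>[x,y]\<^sup>n\<close> in the generators \<open>S\<close> projects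
  to a closed planar path whose steps are the projections of \<open>S\<close>. Its length \<open>L\<close> is
  comparable to \<open>\<surd>n\<close>, and its doubled area \<open>A\<close> differs from \<open>2n\<close> by at most a multiple of \<open>L\<close>, because
  every letter adds a bounded height of its own. An element \<open>h = (v, t)\<close> of length at most \<open>D\<close>
  satisfies \<open>|v| = O(D)\<close> and \<open>t = O(D\<^sup>2)\<close>, and both \<open>|v|\<^sup>2\<close> and \<open>t\<close> are \<open>O(L)\<close> as soon as \<open>D\<^sup>4 \<le> n\<close>.

  Errors of order \<open>L\<close> in the area cost only a bounded number of letters. A constant number \<open>2j\<close> of
  additional steps raises the area by a multiple of \<open>j L\<close> (lemma \<open>boost_area\<close>). Conversely, a path with
  too much area can be rearranged: adjacent transpositions, each changing the area by a bounded
  amount, lead from a path to its reversal, which has the opposite area, so every value in between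
  is attained up to a bounded error (lemma \<open>area_interpolation\<close>). What is left at the end is a bounded
  central error, corrected by a bounded number of letters.

  It therefore suffices to move the endpoint of a closed path from \<open>0\<close> to \<open>v\<close> without lengthening the path
  by more than a constant and without losing more than \<open>O(L)\<close> of area (lemma \<open>move_endpoint\<close>). Let \<open>m\<close> be
  the least number of steps with sum \<open>v\<close>. Up to such errors, two operations cancel each other.

  \<^item> Remove about \<open>m\<close> steps, the same proportion of every kind, so that the path still closes up to a
    bounded defect. If the steps of each kind that contribute least are chosen, at most the average
    share \<open>2 m A / L\<close> of the area is lost (lemma \<open>shrink\<close>).

  \<^item> Insert \<open>m\<close> steps with sum \<open>v\<close> where \<open>wedge _ v\<close> is largest on the path, and start the path where it
    is smallest. The doubled area grows by \<open>2 W\<close>, where \<open>W\<close> is the difference of these extreme values.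
    By convexity there is a linear functional \<open>\<phi>\<close> with \<open>|\<phi>| \<le> 1\<close> on all steps and \<open>\<phi> v\<close> equal to
    \<open>m\<close> up to a constant. In the coordinates \<open>wedge _ v\<close> and \<open>\<phi>\<close>, the number \<open>\<phi> v \<cdot> A\<close> is twice the
    integral of \<open>wedge _ v\<close> against \<open>d\<phi>\<close> along the closed path, hence at most \<open>W L\<close>
    (lemma \<open>wide_rotation\<close>). So the gain is at least \<open>2 m A / L\<close>, up to \<open>O(L)\<close>.

  In this way \<open>[x,y]\<^sup>n h\<close> is spelled with \<open>L + O(1)\<close> letters.\<close>

section \<open>Signed area of planar paths\<close>

definition wedge :: "real \<times> real \<Rightarrow> real \<times> real \<Rightarrow> real" where
  "wedge a b = fst a * snd b - snd a * fst b"

lemma wedge_simps [simp]: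
  "wedge 0 b = 0" "wedge a 0 = 0" "wedge a a = 0"
  "wedge (- a) b = - wedge a b" "wedge a (- b) = - wedge a b"
  by (simp_all add: wedge_def)

lemma wedge_add:
  "wedge (a + b) c = wedge a c + wedge b c" "wedge c (a + b) = wedge c a + wedge c b"
  "wedge (a - b) c = wedge a c - wedge b c" "wedge c (a - b) = wedge c a - wedge c b"
  by (simp_all add: wedge_def algebra_simps)

lemma wedge_scaleR [simp]: "wedge (x *\<^sub>R a) b = x * wedge a b" "wedge a (x *\<^sub>R b) = x * wedge a b"
  by (simp_all add: wedge_def algebra_simps)

lemma wedge_swap: "wedge a b = - wedge b a"
  by (simp add: wedge_def)

lemma wedge_sum: "wedge (sum f A) c = (\<Sum>i\<in>A. wedge (f i) c)" "wedge c (sum f A) = (\<Sum>i\<in>A. wedge c (f i))"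
  by (induction A rule: infinite_finite_induct) (auto simp: wedge_add)

lemma abs_wedge_le: "\<bar>wedge a b\<bar> \<le> 2 * norm a * norm b"
proof -
  have "\<bar>wedge a b\<bar> \<le> \<bar>fst a\<bar> * \<bar>snd b\<bar> + \<bar>snd a\<bar> * \<bar>fst b\<bar>"
    unfolding wedge_def abs_mult[symmetric] by linarith
  also have "\<dots> \<le> norm a * norm b + norm a * norm b"
    using norm_fst_le[of "fst a" "snd a"] norm_snd_le[of "snd a" "fst a"]
      norm_fst_le[of "fst b" "snd b"] norm_snd_le[of "snd b" "fst b"]
    by (intro add_mono mult_mono) auto
  finally show ?thesis by simp
qed

text \<open>Twice the signed area enclosed by the path with steps \<open>w\<close> and the chord from its end back to its
  start. The area is taken relative to the chord so that it is defined for paths that do not close,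
  and so that it is exactly the height of an element of the Heisenberg group below.\<close>

fun area :: "(real \<times> real) list \<Rightarrow> real" where
  "area [] = 0"
| "area (a # w) = wedge a (sum_list w) + area w"

lemma area_append: "area (u @ w) = area u + area w + wedge (sum_list u) (sum_list w)"
  by (induction u) (auto simp: wedge_add)

text \<open>The path with the steps in reverse order is the original path, traversed backwards and then
  rotated by half a turn.\<close>

lemma area_rev: "area (rev w) = - area w"
proof (induction w)
  case (Cons a w)
  then show ?case using wedge_swap[of a "sum_list w"] by (simp add: area_append sum_list_rev)
qed simp

lemma sum_list_replicate_vec: "sum_list (replicate j p) = real j *\<^sub>R (p :: real \<times> real)"
  by (induction j) (auto simp: algebra_simps)

lemma area_replicate [simp]: "area (replicate j p) = 0"
  by (induction j) (auto simp: sum_list_replicate_vec)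

lemma norm_sum_list_le:
  fixes w :: "(real \<times> real) list"
  assumes "\<And>p. p \<in> set w \<Longrightarrow> norm p \<le> r"
  shows "norm (sum_list w) \<le> r * length w"
  using assms
proof (induction w)
  case (Cons a w)
  have "norm (a + sum_list w) \<le> norm a + norm (sum_list w)" by (rule norm_triangle_ineq)
  also have "\<dots> \<le> r + r * length w" using Cons by (intro add_mono) auto
  finally show ?case by (simp add: algebra_simps)
qed simp

lemma abs_area_le:
  assumes "\<And>p. p \<in> set w \<Longrightarrow> norm p \<le> r" and "r \<ge> 0"
  shows "\<bar>area w\<bar> \<le> 2 * r\<^sup>2 * (length w)\<^sup>2"
  using assms(1)
proof (induction w)
  case (Cons a w)
  have "\<bar>wedge a (sum_list w)\<bar> \<le> 2 * norm a * norm (sum_list w)" by (rule abs_wedge_le)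
  also have "\<dots> \<le> 2 * r * (r * length w)"
    using Cons.prems norm_sum_list_le[of w r] \<open>r \<ge> 0\<close> by (intro mult_mono) auto
  finally have "\<bar>area (a # w)\<bar> \<le> 2 * r * (r * length w) + 2 * r\<^sup>2 * (length w)\<^sup>2"
    using Cons by (auto intro: order.trans[OF abs_triangle_ineq] add_mono)
  also have "\<dots> \<le> 2 * r\<^sup>2 * (length (a # w))\<^sup>2"
    by (simp add: power2_eq_square algebra_simps mult_nonneg_nonneg \<open>r \<ge> 0\<close>)
  finally show ?case .
qed simp

lemma area_rotate:
  assumes "sum_list (x @ y) = 0"
  shows "area (y @ x) = area (x @ y)"
proof -
  have "sum_list y = - sum_list x" using assms by (simp add: eq_neg_iff_add_eq_0 add.commute)
  then show ?thesis by (simp add: area_append)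
qed

text \<open>Inserting steps with sum \<open>v\<close> into a closed path shifts the rest of the path by \<open>v\<close>. This
  sweeps out the parallelogram spanned by \<open>v\<close> and the displacement from the start of the path to
  the insertion.\<close>

lemma area_insert:
  assumes "sum_list (q1 @ q2) = 0"
  shows "area (q1 @ u @ q2) = area (q1 @ q2) + area u + 2 * wedge (sum_list q1) (sum_list u)"
proof -
  have "sum_list q2 = - sum_list q1" using assms by (simp add: eq_neg_iff_add_eq_0 add.commute)
  then show ?thesis using wedge_swap[of "sum_list u" "sum_list q1"]
    by (simp add: area_append wedge_add)
qed

text \<open>Unless \<open>a \<bullet> v = 0\<close>, the two functionals \<open>\<lambda>x. wedge x v\<close> and \<open>\<lambda>x. a \<bullet> x\<close> are coordinates on the plane, and
  the identity expresses the area form in them.\<close>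

lemma wedge_coordinates:
  "wedge x y * (a \<bullet> v) = wedge x v * (a \<bullet> y) - (a \<bullet> x) * wedge y v" for a :: "real \<times> real"
  by (simp add: wedge_def inner_prod_def algebra_simps)

section \<open>Removing steps from a closed path\<close>

lemma nths_snoc: "nths (w @ [a]) J = nths w J @ (if length w \<in> J then [a] else [])"
  by (simp add: nths_append)

lemma sum_list_nths:
  "sum_list (nths w J) = (\<Sum>i\<in>J \<inter> {..<length w}. w ! i)" for w :: "'a::comm_monoid_add list"
proof (induction w rule: rev_induct)
  case (snoc a w)
  have *: "J \<inter> {..<length (w @ [a])} = (if length w \<in> J then insert (length w) (J \<inter> {..<length w}) else J \<inter> {..<length w})"
    by (auto simp: less_Suc_eq)
  have "(\<Sum>i\<in>J \<inter> {..<length w}. (w @ [a]) ! i) = (\<Sum>i\<in>J \<inter> {..<length w}. w ! i)"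
    by (rule sum.cong) (auto simp: nth_append)
  then show ?case using snoc unfolding * nths_snoc by (simp add: add.commute)
qed simp

text \<open>The area of a path is the sum of these terms over all pairs of steps. Written as a double sum over
  index sets, it can be restricted to a subset of the steps.\<close>

definition ordered_wedge :: "(real \<times> real) list \<Rightarrow> nat \<Rightarrow> nat \<Rightarrow> real" where
  "ordered_wedge w i j = (if i < j then wedge (w ! i) (w ! j) else 0)"

lemma area_nths:
  "area (nths w J) = (\<Sum>i\<in>J \<inter> {..<length w}. \<Sum>j\<in>J \<inter> {..<length w}. ordered_wedge w i j)"
proof (induction w rule: rev_induct)
  case (snoc a w)
  let ?X = "J \<inter> {..<length w}"
  have *: "J \<inter> {..<length (w @ [a])} = (if length w \<in> J then insert (length w) ?X else ?X)"
    by (auto simp: less_Suc_eq)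
  have 1: "(\<Sum>i\<in>?X. \<Sum>j\<in>?X. ordered_wedge (w @ [a]) i j) = (\<Sum>i\<in>?X. \<Sum>j\<in>?X. ordered_wedge w i j)"
    by (intro sum.cong) (auto simp: nth_append ordered_wedge_def)
  have 2: "(\<Sum>i\<in>?X. ordered_wedge (w @ [a]) i (length w)) = wedge (sum_list (nths w J)) a"
    unfolding sum_list_nths wedge_sum
    by (intro sum.cong) (auto simp: nth_append ordered_wedge_def)
  have 3: "(\<Sum>j\<in>?X. ordered_wedge (w @ [a]) (length w) j) = 0"
    by (intro sum.neutral) (auto simp: ordered_wedge_def)
  have 4: "ordered_wedge (w @ [a]) (length w) (length w) = 0" by (simp add: ordered_wedge_def)
  show ?case using snoc 1 2 3 4 unfolding * nths_snoc
    by (simp add: area_append sum.distrib)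
qed simp

lemma take_sum: "k \<le> length w \<Longrightarrow> sum_list (take k w) = (\<Sum>i<k. w ! i)" for w :: "'a::comm_monoid_add list"
  by (simp add: sum_list_sum_nth atLeast0LessThan)

lemma sum_list_take_Suc: "k < length w \<Longrightarrow> sum_list (take (Suc k) w) = sum_list (take k w) + w ! k"
  for w :: "'a::comm_monoid_add list"
  by (simp add: take_Suc_conv_app_nth)

lemma area_eq_sum: "area w = (\<Sum>k<length w. wedge (sum_list (take k w)) (w ! k))"
proof (induction w rule: rev_induct)
  case (snoc a w)
  have "(\<Sum>k<length w. wedge (sum_list (take k (w @ [a]))) ((w @ [a]) ! k)) = area w"
    unfolding snoc by (intro sum.cong) (auto simp: nth_append)
  then show ?case by (simp add: area_append)
qed simp

text \<open>The double sum for the steps that stay is the full one minus all terms involving a removed step,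
  where pairs of removed steps have been subtracted twice. On a closed path, the steps before
  and after step \<open>k\<close> contribute equally to the terms involving \<open>k\<close>.\<close>

lemma area_remove:
  assumes closed: "sum_list w = 0" and I: "I \<subseteq> {..<length w}"
  shows "area (nths w (- I)) =
    area w - 2 * (\<Sum>k\<in>I. wedge (sum_list (take k w)) (w ! k)) + area (nths w I)"
proof -
  let ?U = "{..<length w}" and ?o = "ordered_wedge w"
  let ?J = "?U - I"
  have J: "- I \<inter> ?U = ?J" and I': "I \<inter> ?U = I" using I by auto
  have split: "(\<Sum>i\<in>?U. f i) = (\<Sum>i\<in>?J. f i) + (\<Sum>i\<in>I. f i)" for f :: "nat \<Rightarrow> real"
    using sum.subset_diff[OF I, of f] by simp
  have U: "area w = (\<Sum>i\<in>?U. \<Sum>j\<in>?U. ?o i j)" using area_nths[of w UNIV] by (simp add: nths_all)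
  have "(\<Sum>j\<in>?U. ?o k j + ?o j k) = 2 * wedge (sum_list (take k w)) (w ! k)" if "k \<in> I" for k
  proof -
    have k: "k < length w" using that I by auto
    have "(\<Sum>j\<in>?U. ?o k j) = (\<Sum>j\<in>{k<..<length w}. wedge (w ! k) (w ! j))"
      by (rule sum.mono_neutral_cong_right) (use k in \<open>auto simp: ordered_wedge_def\<close>)
    also have "\<dots> = wedge (w ! k) (\<Sum>j\<in>{k<..<length w}. w ! j)" by (simp add: wedge_sum)
    also have "(\<Sum>j\<in>{k<..<length w}. w ! j) = - sum_list (take k w) - w ! k"
    proof -
      have U_eq: "?U = insert k ({..<k} \<union> {k<..<length w})" using k by auto
      have "(\<Sum>j\<in>?U. w ! j) = w ! k + (\<Sum>j\<in>{..<k} \<union> {k<..<length w}. w ! j)"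
        unfolding U_eq by (rule sum.insert) auto
      also have "(\<Sum>j\<in>{..<k} \<union> {k<..<length w}. w ! j) = (\<Sum>j<k. w ! j) + (\<Sum>j\<in>{k<..<length w}. w ! j)"
        by (rule sum.union_disjoint) auto
      finally have "(\<Sum>j\<in>?U. w ! j) = w ! k + ((\<Sum>j<k. w ! j) + (\<Sum>j\<in>{k<..<length w}. w ! j))" .
      moreover have "(\<Sum>j\<in>?U. w ! j) = 0" using closed by (simp add: sum_list_sum_nth atLeast0LessThan)
      ultimately show ?thesis using k by (simp add: take_sum algebra_simps eq_neg_iff_add_eq_0)
    qed
    finally have 1: "(\<Sum>j\<in>?U. ?o k j) = wedge (sum_list (take k w)) (w ! k)"
      using wedge_swap[of "w ! k"] by (simp add: wedge_add)
    have "(\<Sum>j\<in>?U. ?o j k) = (\<Sum>j<k. wedge (w ! j) (w ! k))"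
      by (rule sum.mono_neutral_cong_right) (use k in \<open>auto simp: ordered_wedge_def\<close>)
    also have "\<dots> = wedge (sum_list (take k w)) (w ! k)" using k by (simp add: take_sum wedge_sum)
    finally show ?thesis using 1 by (simp add: sum.distrib)
  qed
  then have "2 * (\<Sum>k\<in>I. wedge (sum_list (take k w)) (w ! k)) = (\<Sum>k\<in>I. \<Sum>j\<in>?U. ?o k j + ?o j k)"
    by (simp add: sum_distrib_left)
  also have "\<dots> = (\<Sum>k\<in>I. \<Sum>j\<in>?J. ?o k j) + (\<Sum>k\<in>I. \<Sum>j\<in>I. ?o k j)
      + (\<Sum>k\<in>I. \<Sum>j\<in>?J. ?o j k) + (\<Sum>k\<in>I. \<Sum>j\<in>I. ?o j k)"
    by (simp add: split sum.distrib)
  also have "(\<Sum>k\<in>I. \<Sum>j\<in>I. ?o j k) = (\<Sum>k\<in>I. \<Sum>j\<in>I. ?o k j)" by (rule sum.swap)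
  also have "(\<Sum>k\<in>I. \<Sum>j\<in>?J. ?o j k) = (\<Sum>j\<in>?J. \<Sum>k\<in>I. ?o j k)" by (rule sum.swap)
  finally show ?thesis
    unfolding U area_nths J I' by (simp add: split sum.distrib)
qed

text \<open>Discarding a largest element does not raise the average, so repeated discarding leaves a
  subset with at most the average of the whole.\<close>

lemma exists_light_subset:
  fixes g :: "'a \<Rightarrow> real"
  assumes "finite X" and "c \<le> card X"
  shows "\<exists>Y\<subseteq>X. card Y = c \<and> real (card X) * sum g Y \<le> real c * sum g X"
  using assms
proof (induction "card X - c" arbitrary: X)
  case 0
  then show ?case by auto
next
  case (Suc d)
  let ?N = "real (card X)"
  have "X \<noteq> {}" using Suc by auto
  then have "Max (g ` X) \<in> g ` X" using Suc.prems by (intro Max_in) auto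
  then obtain x where x: "x \<in> X" "g x = Max (g ` X)" by auto
  have gx: "g y \<le> g x" if "y \<in> X" for y
    unfolding x(2) using that Suc.prems by (intro Max_ge) auto
  have "sum g X \<le> ?N * g x" using gx sum_bounded_above[of X g "g x"] by simp
  have "card X \<ge> 1" using x Suc.prems by (auto simp: card_gt_0_iff Suc_le_eq)
  then have cX: "real (card (X - {x})) = ?N - 1" "card (X - {x}) = card X - 1" and N: "?N \<ge> 1"
    using x Suc.prems by (auto simp: of_nat_diff)
  have sX: "sum g (X - {x}) = sum g X - g x" using x Suc.prems by (simp add: sum_diff1)
  obtain Y where Y: "Y \<subseteq> X - {x}" "card Y = c" "(?N - 1) * sum g Y \<le> real c * (sum g X - g x)"
  proof -
    have "d = card (X - {x}) - c" "finite (X - {x})" "c \<le> card (X - {x})"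
      using Suc.hyps(2) Suc.prems cX(2) by auto
    then have "\<exists>Y\<subseteq>X - {x}. card Y = c \<and> real (card (X - {x})) * sum g Y \<le> real c * sum g (X - {x})"
      by (rule Suc.hyps(1))
    then show thesis using that unfolding cX(1) sX by blast
  qed
  show ?case
  proof (cases "c = 0")
    case True
    then show ?thesis by (intro exI[of _ "{}"]) auto
  next
    case False
    then have N1: "?N - 1 > 0" using Suc by linarith
    have "(?N - 1) * (?N * sum g Y) \<le> ?N * (real c * (sum g X - g x))"
      using mult_left_mono[OF Y(3), of ?N] by (simp add: mult.left_commute)
    also have "\<dots> = real c * (?N * sum g X - ?N * g x)" by (simp add: algebra_simps)
    also have "\<dots> \<le> real c * (?N * sum g X - sum g X)" using \<open>sum g X \<le> ?N * g x\<close>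
      by (intro mult_left_mono) auto
    also have "\<dots> = (?N - 1) * (real c * sum g X)" by (simp add: algebra_simps)
    finally have "?N * sum g Y \<le> real c * sum g X" using N1 by (simp only: mult_le_cancel_left_pos)
    then show ?thesis using Y by blast
  qed
qed

section \<open>Finite symmetric sets of steps\<close>

text \<open>Integer vectors are represented inside \<open>real \<times> real\<close>, where convexity and linear functionals live.\<close>

definition integer_points :: "(real \<times> real) set" where
  "integer_points = \<int> \<times> \<int>"

lemma integer_points_add [intro]: "u \<in> integer_points \<Longrightarrow> v \<in> integer_points \<Longrightarrow> u + v \<in> integer_points"
  and integer_points_minus [intro]: "u \<in> integer_points \<Longrightarrow> - u \<in> integer_points"
  by (auto simp: integer_points_def)

lemma finite_bounded_integer_points: "finite {v \<in> integer_points. norm v \<le> B}"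
proof -
  have fin: "finite {x \<in> \<int>. \<bar>x\<bar> \<le> B}" by (rule finite_abs_int_segment)
  have "{v \<in> integer_points. norm v \<le> B} \<subseteq> {x \<in> \<int>. \<bar>x\<bar> \<le> B} \<times> {x \<in> \<int>. \<bar>x\<bar> \<le> B}"
  proof
    fix v assume v: "v \<in> {v \<in> integer_points. norm v \<le> B}"
    then have "\<bar>fst v\<bar> \<le> B" "\<bar>snd v\<bar> \<le> B"
      using norm_fst_le[of "fst v" "snd v"] norm_snd_le[of "snd v" "fst v"] by auto
    then show "v \<in> {x \<in> \<int>. \<bar>x\<bar> \<le> B} \<times> {x \<in> \<int>. \<bar>x\<bar> \<le> B}" using v by (auto simp: integer_points_def)
  qed
  then show ?thesis using fin by (meson finite_SigmaI finite_subset)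
qed

lemma sum_list_as_sum:
  fixes w :: "(real \<times> real) list"
  assumes "set w \<subseteq> P" and "finite P"
  shows "sum_list w = (\<Sum>p\<in>P. real (card {k. k < length w \<and> w ! k = p}) *\<^sub>R p)"
proof -
  have "sum_list w = (\<Sum>k<length w. w ! k)" by (simp add: sum_list_sum_nth atLeast0LessThan)
  also have "\<dots> = (\<Sum>p\<in>P. \<Sum>k\<in>{k \<in> {..<length w}. w ! k = p}. w ! k)"
  proof (rule sum.group[symmetric])
    show "(!) w ` {..<length w} \<subseteq> P" using assms(1) nth_mem by blast
  qed (simp_all add: assms(2))
  also have "\<dots> = (\<Sum>p\<in>P. \<Sum>k\<in>{k \<in> {..<length w}. w ! k = p}. p)" by (intro sum.cong) auto
  also have "\<dots> = (\<Sum>p\<in>P. real (card {k. k < length w \<and> w ! k = p}) *\<^sub>R p)"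
    by (intro sum.cong HOL.refl) (simp add: sum_constant_scaleR)
  finally show ?thesis .
qed

text \<open>The properties of the planar projections of a finite symmetric generating set of the
  Heisenberg group.\<close>

locale step_set =
  fixes P :: "(real \<times> real) set"
  assumes finite_P: "finite P"
    and minus_P: "p \<in> P \<Longrightarrow> - p \<in> P"
    and P_integer: "P \<subseteq> integer_points"
    and reach: "v \<in> integer_points \<Longrightarrow> \<exists>w. set w \<subseteq> P \<and> sum_list w = v"
begin

definition radius :: real where "radius = Max (insert 1 (norm ` P))"

lemma radius_ge_1: "radius \<ge> 1" and norm_le_radius: "p \<in> P \<Longrightarrow> norm p \<le> radius"
  unfolding radius_def using finite_P by (auto intro!: Max_ge)

lemma radius_nonneg: "radius \<ge> 0" using radius_ge_1 by simp

lemma sum_list_integer: "set w \<subseteq> P \<Longrightarrow> sum_list w \<in> integer_points"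
  using P_integer by (induction w) (auto simp: integer_points_def zero_prod_def)

lemma norm_word_le: "set w \<subseteq> P \<Longrightarrow> norm (sum_list w) \<le> radius * length w"
  using norm_sum_list_le[of w radius] norm_le_radius by auto

lemma area_word_le: "set w \<subseteq> P \<Longrightarrow> \<bar>area w\<bar> \<le> 2 * radius\<^sup>2 * (length w)\<^sup>2"
  using abs_area_le[of w radius] norm_le_radius radius_nonneg by auto

text \<open>Bounded defects in the endpoint of a path are repaired with boundedly many steps, because there are
  only finitely many integer vectors of bounded norm.\<close>

lemma bounded_reach:
  "\<exists>E. \<forall>v\<in>integer_points. norm v \<le> B \<longrightarrow> (\<exists>e. set e \<subseteq> P \<and> sum_list e = v \<and> length e \<le> E)"
proof -
  define f where "f v = (SOME e. set e \<subseteq> P \<and> sum_list e = v)" for v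
  have f: "set (f v) \<subseteq> P \<and> sum_list (f v) = v" if "v \<in> integer_points" for v
    unfolding f_def using reach[OF that] by (rule someI_ex)
  have "length (f v) \<le> Max ((length \<circ> f) ` {v \<in> integer_points. norm v \<le> B})" if "v \<in> integer_points" "norm v \<le> B" for v
    using that finite_bounded_integer_points by (intro Max_ge) auto
  then show ?thesis using f by blast
qed

section \<open>Shortening a closed path\<close>

text \<open>Of the \<open>N\<close> steps equal to \<open>p\<close>, remove \<open>\<lfloor>m N / L\<rfloor>\<close>. Exact proportions would leave the path closed;
  rounding moves the endpoint by a bounded integer vector. Step \<open>k\<close> at position \<open>P\<close> costs
  \<open>2 wedge P k\<close> to first order, and these numbers add up to twice the area, so removing
  the cheapest steps of each kind loses no more than the proportion \<open>2 m / L\<close> of the area. The rounding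
  contributes \<open>O(L)\<close> for each kind, the interaction of removed steps \<open>O(m\<^sup>2)\<close>. The bound
  is multiplied by \<open>L\<close>, which makes it meaningful for the empty path as well.\<close>

lemma shrink:
  "\<exists>K\<ge>0. \<forall>w m. set w \<subseteq> P \<longrightarrow> sum_list w = 0 \<longrightarrow> m \<le> length w \<longrightarrow>
    (\<exists>w'. set w' \<subseteq> P \<and> sum_list w' = 0 \<and> real (length w') \<le> real (length w) - real m + K \<and>
       real (length w) * area w' \<ge> real (length w) * area w - 2 * real m * area w
          - K * real (length w) * (real (length w) + (real m)\<^sup>2))"
proof -
  let ?c = "real (card P)"
  obtain E where E: "\<And>v. v \<in> integer_points \<Longrightarrow> norm v \<le> ?c * radius \<Longrightarrow>
      \<exists>e. set e \<subseteq> P \<and> sum_list e = v \<and> length e \<le> E"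
    using bounded_reach by meson
  define K where "K = 4 * radius\<^sup>2 * ?c + 2 * radius\<^sup>2 * (real E)\<^sup>2 + 2 * radius\<^sup>2 + ?c + real E"
  have "K \<ge> 0" by (simp add: K_def)
  moreover have "\<exists>w'. set w' \<subseteq> P \<and> sum_list w' = 0 \<and> real (length w') \<le> real (length w) - real m + K \<and>
       real (length w) * area w' \<ge> real (length w) * area w - 2 * real m * area w
          - K * real (length w) * (real (length w) + (real m)\<^sup>2)"
    if w: "set w \<subseteq> P" and closed: "sum_list w = 0" and m: "m \<le> length w" for w m
  proof (cases "w = []")
    case True
    then show ?thesis using \<open>K \<ge> 0\<close> m by (intro exI[of _ "[]"]) auto
  next
    case False
    define L where "L = length w"
    then have L: "real L \<ge> 1" using False by (simp add: Suc_le_eq)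
    then have L0: "real L > 0" by linarith
    \<comment> \<open>\<open>2 g k\<close> is the first-order cost of removing step \<open>k\<close>.\<close>
    define g where "g k = wedge (sum_list (take k w)) (w ! k)" for k
    define X where "X p = {k. k < L \<and> w ! k = p}" for p
    define c where "c p = (m * card (X p)) div L" for p
    have finX: "finite (X p)" for p by (simp add: X_def)
    have cX: "c p \<le> card (X p)" for p
    proof -
      have "m * card (X p) \<le> L * card (X p)" using m by (simp add: L_def)
      then have "c p \<le> (L * card (X p)) div L" unfolding c_def by (rule div_le_mono)
      then show ?thesis using L by simp
    qed
    have c_le: "real L * c p \<le> real m * card (X p)" and c_ge: "real m * card (X p) \<le> real L * c p + L" for p
    proof -
      have "L * c p \<le> m * card (X p)" unfolding c_def by simp
      then have "real (L * c p) \<le> real (m * card (X p))" by (simp only: of_nat_le_iff)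
      then show "real L * c p \<le> real m * card (X p)" by simp
      have "m * card (X p) < L * c p + L"
        using dividend_less_times_div[of L "m * card (X p)"] L by (simp add: c_def)
      then have "real (m * card (X p)) \<le> real (L * c p + L)" by (simp only: of_nat_le_iff less_imp_le)
      then show "real m * card (X p) \<le> real L * c p + L" by simp
    qed
    have "\<exists>Y\<subseteq>X p. card Y = c p \<and> real (card (X p)) * sum g Y \<le> real (c p) * sum g (X p)" for p
      using exists_light_subset[OF finX cX] by blast
    then obtain Y where Y: "\<And>p. Y p \<subseteq> X p" "\<And>p. card (Y p) = c p"
      "\<And>p. real (card (X p)) * sum g (Y p) \<le> real (c p) * sum g (X p)" by metis
    define I where "I = (\<Union>p\<in>P. Y p)"
    have disj: "Y p \<inter> Y q = {}" if "p \<noteq> q" for p q using Y(1)[of p] Y(1)[of q] that by (auto simp: X_def)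
    have finY: "finite (Y p)" for p using Y(1) finX by (rule finite_subset)
    have IL: "I \<subseteq> {..<length w}" using Y(1) by (auto simp: I_def X_def L_def)
    have sum_I: "sum f I = (\<Sum>p\<in>P. sum f (Y p))" for f :: "nat \<Rightarrow> 'z::comm_monoid_add"
      unfolding I_def using finite_P finY disj by (intro sum.UNION_disjoint) auto
    have cardI: "card I = (\<Sum>p\<in>P. c p)" using sum_I[of "\<lambda>_. 1::nat"] Y(2) by simp
    have UX: "(\<Sum>p\<in>P. sum f (X p)) = sum f {..<L}" for f :: "nat \<Rightarrow> real"
    proof -
      have "(!) w ` {..<L} \<subseteq> P" using w nth_mem unfolding L_def by blast
      then show ?thesis using sum.group[of "{..<L}" P "\<lambda>k. w ! k" f] finite_P by (simp add: X_def)
    qed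
    have sum_cardX: "(\<Sum>p\<in>P. real (card (X p))) = L" using UX[of "\<lambda>_. 1"] by simp
    have Lc: "real L * card I = (\<Sum>p\<in>P. real L * c p)" by (simp add: cardI sum_distrib_left)
    have "real L * card I \<le> (\<Sum>p\<in>P. real m * card (X p))" unfolding Lc by (intro sum_mono c_le)
    also have "\<dots> = real L * m" by (simp add: sum_distrib_left[symmetric] sum_cardX)
    finally have "real L * real (card I) \<le> real L * real m" .
    from mult_left_le_imp_le[OF this L0] have I_le: "real (card I) \<le> real m" .
    have "real L * m = (\<Sum>p\<in>P. real m * card (X p))" by (simp add: sum_distrib_left[symmetric] sum_cardX)
    also have "\<dots> \<le> (\<Sum>p\<in>P. real L * c p + L)" by (intro sum_mono c_ge)
    also have "\<dots> = real L * (card I + ?c)" by (simp add: sum.distrib Lc algebra_simps)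
    finally have "real L * real m \<le> real L * (real (card I) + ?c)" .
    from mult_left_le_imp_le[OF this L0] have I_ge: "real m \<le> real (card I) + ?c" .
    have g_bound: "\<bar>g k\<bar> \<le> 2 * radius\<^sup>2 * L" if "k < L" for k
    proof -
      have "set (take k w) \<subseteq> P" using order_trans[OF set_take_subset w] .
      then have "norm (sum_list (take k w)) \<le> radius * length (take k w)" by (rule norm_word_le)
      also have "\<dots> \<le> radius * L" using radius_nonneg by (intro mult_left_mono) (auto simp: L_def)
      finally have 1: "norm (sum_list (take k w)) \<le> radius * L" .
      have "norm (w ! k) \<le> radius" using that w norm_le_radius nth_mem[of k w] unfolding L_def by blast
      then have "2 * norm (sum_list (take k w)) * norm (w ! k) \<le> 2 * (radius * L) * radius"
        using 1 radius_nonneg by (intro mult_mono) auto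
      then show ?thesis unfolding g_def using abs_wedge_le[of "sum_list (take k w)" "w ! k"]
        by (simp add: power2_eq_square algebra_simps)
    qed
    have Yg: "real L * sum g (Y p) \<le> real m * sum g (X p) + L * (2 * radius\<^sup>2 * L)" for p
    proof (cases "card (X p) = 0")
      case True
      then have "X p = {}" "Y p = {}" using finX Y(1)[of p] by auto
      then show ?thesis by simp
    next
      case False
      define N where "N = real (card (X p))"
      have N: "N > 0" using False by (simp add: N_def)
      have avg: "\<bar>sum g (X p) / N\<bar> \<le> 2 * radius\<^sup>2 * L"
      proof -
        have "\<bar>sum g (X p)\<bar> \<le> (\<Sum>k\<in>X p. \<bar>g k\<bar>)" by (rule sum_abs)
        also have "\<dots> \<le> N * (2 * radius\<^sup>2 * L)" unfolding N_def
          by (intro sum_bounded_above) (auto simp: X_def g_bound)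
        finally show ?thesis using N by (simp add: field_simps)
      qed
      have "N * sum g (Y p) \<le> N * (c p * (sum g (X p) / N))" using Y(3)[of p] N by (simp add: N_def)
      from mult_left_le_imp_le[OF this N] have "sum g (Y p) \<le> c p * (sum g (X p) / N)" .
      from mult_left_mono[OF this, of "real L"]
      have "real L * sum g (Y p) \<le> (real L * c p) * (sum g (X p) / N)"
        by (simp only: mult.assoc of_nat_0_le_iff)
      also have "\<dots> = real m * N * (sum g (X p) / N) + (real L * c p - real m * N) * (sum g (X p) / N)"
        by (simp add: algebra_simps)
      also have "(real L * c p - real m * N) * (sum g (X p) / N) \<le> L * (2 * radius\<^sup>2 * L)"
      proof -
        have "\<bar>real L * c p - real m * N\<bar> \<le> L" using c_le[of p] c_ge[of p] by (auto simp: N_def)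
        then have "\<bar>(real L * c p - real m * N) * (sum g (X p) / N)\<bar> \<le> L * (2 * radius\<^sup>2 * L)"
          unfolding abs_mult using avg L by (intro mult_mono) auto
        then show ?thesis by linarith
      qed
      finally show ?thesis using N by simp
    qed
    have "real L * sum g I \<le> (\<Sum>p\<in>P. real m * sum g (X p) + L * (2 * radius\<^sup>2 * L))"
      unfolding sum_I sum_distrib_left by (intro sum_mono) (use Yg in \<open>simp add: sum_distrib_left\<close>)
    also have "\<dots> = real m * sum g {..<L} + ?c * (L * (2 * radius\<^sup>2 * L))"
      by (simp add: sum.distrib sum_distrib_left[symmetric] UX)
    also have "sum g {..<L} = area w" by (simp add: area_eq_sum g_def L_def)
    finally have gI: "real L * sum g I \<le> real m * area w + ?c * (L * (2 * radius\<^sup>2 * L))" .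
    define kept where "kept = nths w (- I)"
    have kept_P: "set kept \<subseteq> P" using order_trans[OF set_nths_subset w] unfolding kept_def .
    have len_kept: "real (length kept) = real L - card I"
    proof -
      have "{i. i < length w \<and> i \<in> - I} = {..<length w} - I" by auto
      moreover have "card I \<le> length w" using card_mono[OF _ IL] by simp
      moreover have "finite I" using IL finite_subset by blast
      ultimately show ?thesis using IL unfolding kept_def length_nths L_def
        by (simp add: card_Diff_subset of_nat_diff)
    qed
    have "sum_list w = (\<Sum>k\<in>- I \<inter> {..<length w}. w ! k) + (\<Sum>k\<in>I. w ! k)"
    proof -
      have "- I \<inter> {..<length w} = {..<length w} - I" by auto
      then show ?thesis unfolding sum_list_sum_nth atLeast0LessThan
        using sum.subset_diff[OF IL, of "(!) w"] by simp
    qed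
    then have kept_sum: "sum_list kept = - (\<Sum>k\<in>I. w ! k)"
      using closed by (simp add: kept_def sum_list_nths eq_neg_iff_add_eq_0)
    have "(\<Sum>k\<in>I. w ! k) = (\<Sum>p\<in>P. \<Sum>k\<in>Y p. p)"
      unfolding sum_I by (intro sum.cong HOL.refl) (use Y(1) in \<open>auto simp: X_def\<close>)
    also have "\<dots> = (\<Sum>p\<in>P. real (c p) *\<^sub>R p)" by (simp add: sum_constant_scaleR Y(2))
    finally have sI: "(\<Sum>k\<in>I. w ! k) = (\<Sum>p\<in>P. real (c p) *\<^sub>R p)" .
    \<comment> \<open>Since the steps with their full multiplicities sum to zero, only the rounding errors \<open>L c p - m |X p|\<close> move the endpoint.\<close>
    have X0: "(\<Sum>p\<in>P. real (card (X p)) *\<^sub>R p) = 0"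
      using sum_list_as_sum[OF w finite_P] closed by (simp add: X_def L_def)
    have "real L *\<^sub>R (\<Sum>k\<in>I. w ! k) = real L *\<^sub>R (\<Sum>k\<in>I. w ! k) - real m *\<^sub>R (\<Sum>p\<in>P. real (card (X p)) *\<^sub>R p)"
      by (simp add: X0)
    also have "\<dots> = (\<Sum>p\<in>P. (real L * c p - real m * card (X p)) *\<^sub>R p)"
      by (simp add: sI scaleR_sum_right sum_subtractf[symmetric] scaleR_diff_left)
    also have "norm \<dots> \<le> (\<Sum>p\<in>P. L * radius)"
    proof (rule sum_norm_le)
      fix p assume "p \<in> P"
      then show "norm ((real L * c p - real m * card (X p)) *\<^sub>R p) \<le> L * radius"
        using c_le[of p] c_ge[of p] norm_le_radius[of p] unfolding norm_scaleR by (intro mult_mono) auto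
    qed
    finally have "real L * norm (\<Sum>k\<in>I. w ! k) \<le> real L * (?c * radius)" by (simp add: mult.left_commute)
    then have "norm (sum_list kept) \<le> ?c * radius" using L by (simp add: kept_sum)
    then obtain e where e: "set e \<subseteq> P" "sum_list e = - sum_list kept" "length e \<le> E"
      using E[of "- sum_list kept"] sum_list_integer[OF kept_P] by auto
    have area_kept: "area (kept @ e) = area w - 2 * sum g I + area (nths w I) + area e"
      using area_remove[OF closed IL] by (simp add: area_append e(2) kept_def g_def)
    have "set (nths w I) \<subseteq> P" using order_trans[OF set_nths_subset w] .
    then have "\<bar>area (nths w I)\<bar> \<le> 2 * radius\<^sup>2 * (length (nths w I))\<^sup>2" by (rule area_word_le)
    also have "length (nths w I) = card I"
    proof -
      have "{i. i < length w \<and> i \<in> I} = I" using IL by auto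
      then show ?thesis by (simp add: length_nths)
    qed
    also have "2 * radius\<^sup>2 * (card I)\<^sup>2 \<le> 2 * radius\<^sup>2 * (real m)\<^sup>2"
      using I_le by (intro mult_left_mono power_mono) auto
    finally have aI: "area (nths w I) \<ge> - (2 * radius\<^sup>2 * (real m)\<^sup>2)" by linarith
    have "\<bar>area e\<bar> \<le> 2 * radius\<^sup>2 * (length e)\<^sup>2" by (rule area_word_le[OF e(1)])
    also have "\<dots> \<le> 2 * radius\<^sup>2 * (real E)\<^sup>2" using e(3) by (intro mult_left_mono power_mono) auto
    finally have ae: "area e \<ge> - (2 * radius\<^sup>2 * (real E)\<^sup>2)" by linarith
    have "real L * area (kept @ e) = real L * area w - 2 * (real L * sum g I) + real L * (area (nths w I) + area e)"
      by (simp add: area_kept algebra_simps)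
    also have "\<dots> \<ge> real L * area w - 2 * (real m * area w + ?c * (L * (2 * radius\<^sup>2 * L)))
        + real L * (- (2 * radius\<^sup>2 * (real m)\<^sup>2) - 2 * radius\<^sup>2 * (real E)\<^sup>2)"
      using gI aI ae L by (intro add_mono diff_mono mult_left_mono) auto
    finally have 1: "real L * area (kept @ e) \<ge> real L * area w - 2 * real m * area w
        - L * (4 * radius\<^sup>2 * ?c * L + 2 * radius\<^sup>2 * (real E)\<^sup>2 + 2 * radius\<^sup>2 * (real m)\<^sup>2)"
      by (simp add: algebra_simps)
    have "4 * radius\<^sup>2 * ?c * L + 2 * radius\<^sup>2 * (real E)\<^sup>2 * 1 + 2 * radius\<^sup>2 * (real m)\<^sup>2
       \<le> 4 * radius\<^sup>2 * ?c * L + 2 * radius\<^sup>2 * (real E)\<^sup>2 * L + 2 * radius\<^sup>2 * (real m)\<^sup>2"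
      using L by (intro add_mono mult_left_mono) auto
    also have "\<dots> \<le> K * L + K * (real m)\<^sup>2"
    proof -
      have "4 * radius\<^sup>2 * ?c * L + 2 * radius\<^sup>2 * (real E)\<^sup>2 * L = (4 * radius\<^sup>2 * ?c + 2 * radius\<^sup>2 * (real E)\<^sup>2) * L"
        by (simp add: algebra_simps)
      also have "\<dots> \<le> K * L" by (intro mult_right_mono) (auto simp: K_def)
      finally have "4 * radius\<^sup>2 * ?c * L + 2 * radius\<^sup>2 * (real E)\<^sup>2 * L \<le> K * L" .
      moreover have "2 * radius\<^sup>2 * (real m)\<^sup>2 \<le> K * (real m)\<^sup>2" by (intro mult_right_mono) (auto simp: K_def)
      ultimately show ?thesis by linarith
    qed
    finally have "real L * (4 * radius\<^sup>2 * ?c * L + 2 * radius\<^sup>2 * (real E)\<^sup>2 + 2 * radius\<^sup>2 * (real m)\<^sup>2) \<le> real L * (K * L + K * (real m)\<^sup>2)"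
      using L by (intro mult_left_mono) auto
    with 1 have 2: "real L * area (kept @ e) \<ge> real L * area w - 2 * real m * area w - K * L * (L + (real m)\<^sup>2)"
      by (simp add: algebra_simps)
    have "real (length (kept @ e)) \<le> L - real m + K"
    proof -
      have "real (length (kept @ e)) \<le> L - real m + ?c + E" using len_kept I_ge e(3) by simp
      also have "\<dots> \<le> L - real m + K" by (simp add: K_def)
      finally show ?thesis .
    qed
    then show ?thesis using 2 kept_P e(1,2) unfolding L_def[symmetric]
      by (intro exI[of _ "kept @ e"]) auto
  qed
  ultimately show ?thesis by blast
qed

section \<open>Supporting functionals and short words\<close>

lemma integer_points_units: "(1, 0) \<in> integer_points" "(0, 1) \<in> integer_points"
  by (auto simp: integer_points_def)

lemma inner_sum_list_le:
  assumes "set w \<subseteq> P" and "\<And>p. p \<in> P \<Longrightarrow> \<bar>a \<bullet> p\<bar> \<le> 1"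
  shows "\<bar>a \<bullet> sum_list w\<bar> \<le> length w"
  using assms(1)
proof (induction w)
  case (Cons p w)
  have "\<bar>a \<bullet> p\<bar> \<le> 1" using Cons.prems assms(2) by simp
  moreover have "\<bar>a \<bullet> sum_list w\<bar> \<le> length w" using Cons by simp
  ultimately show ?case unfolding sum_list.Cons inner_add_right length_Cons by linarith
qed simp

text \<open>Let \<open>s v\<close> be the last point of the ray through \<open>v\<close> in the convex hull \<open>H\<close> of \<open>P\<close>. A line separating \<open>H\<close>
  from the rest of the ray supports \<open>H\<close> at \<open>s v\<close>, and its normal, scaled to be \<open>1\<close> there, is \<open>a\<close>.
  Writing \<open>s v\<close> as a convex combination of \<open>P\<close> gives the coefficients \<open>c\<close>. In other words, \<open>a\<close> and \<open>c\<close>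
  certify from both sides that \<open>a \<bullet> v\<close> is the length of \<open>v\<close> in the norm with unit ball \<open>H\<close>.\<close>

lemma norm_functional:
  assumes "v \<in> integer_points" and "v \<noteq> 0"
  shows "\<exists>a c. (\<forall>p\<in>P. \<bar>a \<bullet> p\<bar> \<le> 1) \<and> a \<bullet> v > 0 \<and>
    (\<forall>p\<in>P. c p \<ge> 0) \<and> (\<Sum>p\<in>P. c p *\<^sub>R p) = v \<and> sum c P = a \<bullet> v"
proof -
  define H where "H = convex hull P"
  have H: "compact H" "convex H" by (auto simp: H_def finite_P finite_imp_compact_convex_hull)
  have PH: "P \<subseteq> H" by (simp add: H_def hull_subset)
  obtain w where w: "set w \<subseteq> P" "sum_list w = v" using reach assms(1) by blast
  then have "w \<noteq> []" using assms(2) by auto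
  then have len: "real (length w) > 0" by simp
  define n where "n p = real (card {k. k < length w \<and> w ! k = p})" for p
  have "sum n P = length w"
  proof -
    have "(!) w ` {..<length w} \<subseteq> P" using w(1) nth_mem by blast
    then show ?thesis
      using sum.group[of "{..<length w}" P "\<lambda>k. w ! k" "\<lambda>_. 1::real"] finite_P by (simp add: n_def)
  qed
  \<comment> \<open>The average of the steps of a word for \<open>v\<close> is a positive multiple of \<open>v\<close> in \<open>H\<close>.\<close>
  then have "(1 / real (length w)) *\<^sub>R v \<in> H"
    unfolding H_def convex_hull_finite[OF finite_P] mem_Collect_eq
    using sum_list_as_sum[OF w(1) finite_P] w(2) len
    by (intro exI[of _ "\<lambda>p. n p / length w"])
       (auto simp: n_def sum_divide_distrib[symmetric] scaleR_sum_right)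
  define T where "T = {t. t *\<^sub>R v \<in> H}"
  have T0: "1 / real (length w) \<in> T" using \<open>_ \<in> H\<close> by (simp add: T_def)
  have "closed T"
    using continuous_closed_vimage[of H "\<lambda>t. t *\<^sub>R v"] compact_imp_closed[OF H(1)]
    by (simp add: T_def vimage_def)
  moreover have "bounded T"
  proof -
    obtain b where b: "\<And>x. x \<in> H \<Longrightarrow> norm x \<le> b" using compact_imp_bounded[OF H(1)] bounded_iff by metis
    have "norm t \<le> b / norm v" if "t \<in> T" for t
      using b[of "t *\<^sub>R v"] that assms(2) by (simp add: T_def field_simps)
    then show ?thesis using bounded_iff by blast
  qed
  ultimately have "compact T" by (simp add: compact_eq_bounded_closed)
  then obtain s where s: "s \<in> T" "\<And>t. t \<in> T \<Longrightarrow> t \<le> s" using compact_attains_sup[of T] T0 by blast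
  have "s > 0" using s(2)[OF T0] len by (meson divide_pos_pos less_le_trans zero_less_one)
  define X where "X = (\<lambda>t. t *\<^sub>R v) ` {s<..}"
  have "linear (\<lambda>t::real. t *\<^sub>R v)" by (rule linear_scale_left)
  then have "convex X" unfolding X_def by (intro convex_linear_image) auto
  moreover have "X \<noteq> {}" by (auto simp: X_def)
  moreover have "H \<inter> X = {}"
  proof -
    have False if "t > s" "t *\<^sub>R v \<in> H" for t using s(2)[of t] that by (simp add: T_def)
    then show ?thesis by (auto simp: X_def)
  qed
  moreover have "H \<noteq> {}" using s by (auto simp: T_def)
  ultimately obtain a b where ab: "a \<noteq> 0" "\<And>x. x \<in> H \<Longrightarrow> a \<bullet> x \<le> b" "\<And>x. x \<in> X \<Longrightarrow> b \<le> a \<bullet> x"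
    using separating_hyperplane_sets[of H X] H(2) by blast
  have le: "s * (a \<bullet> v) \<le> b" using ab(2)[of "s *\<^sub>R v"] s(1) by (simp add: T_def)
  have X_le: "b \<le> t * (a \<bullet> v)" if "t > s" for t
  proof -
    have "t *\<^sub>R v \<in> X" unfolding X_def using that by (intro imageI) simp
    then show ?thesis using ab(3) by fastforce
  qed
  have "s * (a \<bullet> v) = b"
  proof (rule ccontr)
    assume "s * (a \<bullet> v) \<noteq> b"
    then have lt: "s * (a \<bullet> v) < b" using le by simp
    show False
    proof (cases "a \<bullet> v \<le> 0")
      case True
      then show False using X_le[of "s + 1"] lt by (simp add: algebra_simps)
    next
      case False
      then have "b \<le> (s + (b - s * (a \<bullet> v)) / (2 * (a \<bullet> v))) * (a \<bullet> v)"
        using lt by (intro X_le) auto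
      also have "\<dots> = s * (a \<bullet> v) + (b - s * (a \<bullet> v)) / 2" using False by (simp add: field_simps)
      finally have "b \<le> s * (a \<bullet> v) + (b - s * (a \<bullet> v)) / 2" .
      moreover have "x < b \<Longrightarrow> \<not> b \<le> x + (b - x) / 2" for x by (simp add: field_simps)
      ultimately show False using lt by blast
    qed
  qed
  have absP: "\<bar>a \<bullet> p\<bar> \<le> b" if "p \<in> P" for p
  proof -
    have "p \<in> H" "- p \<in> H" using that minus_P[OF that] PH by blast+
    then show ?thesis using ab(2)[of p] ab(2)[of "- p"] by simp
  qed
  have "P \<noteq> {}" using w \<open>w \<noteq> []\<close> by auto
  then obtain p where "p \<in> P" by blast
  then have "b \<ge> 0" using absP[of p] by linarith
  \<comment> \<open>Otherwise \<open>a\<close> vanishes on all steps, hence on all integer vectors.\<close>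
  moreover have "b \<noteq> 0"
  proof
    assume "b = 0"
    then have P0: "a \<bullet> p = 0" if "p \<in> P" for p using absP[OF that] by simp
    have w0: "a \<bullet> sum_list w = 0" if "set w \<subseteq> P" for w using that by (induction w) (auto simp: inner_add_right P0)
    have "a \<bullet> x = 0" if "x \<in> integer_points" for x using reach[OF that] w0 by blast
    from this[OF integer_points_units(1)] this[OF integer_points_units(2)]
    have "fst a = 0" "snd a = 0" by (auto simp: inner_prod_def)
    with ab(1) show False by (simp add: prod_eq_iff)
  qed
  ultimately have "b > 0" by simp
  obtain u where u: "\<forall>x\<in>P. 0 \<le> u x" "sum u P = 1" "(\<Sum>x\<in>P. u x *\<^sub>R x) = s *\<^sub>R v"
    using s(1) unfolding T_def H_def convex_hull_finite[OF finite_P] by blast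
  have av: "((1 / b) *\<^sub>R a) \<bullet> v = 1 / s" using \<open>s * (a \<bullet> v) = b\<close> \<open>b > 0\<close> \<open>s > 0\<close> by (simp add: field_simps)
  have "(\<Sum>p\<in>P. (u p / s) *\<^sub>R p) = (1 / s) *\<^sub>R (\<Sum>p\<in>P. u p *\<^sub>R p)" by (simp add: scaleR_sum_right)
  then have "(\<Sum>p\<in>P. (u p / s) *\<^sub>R p) = v" using u(3) \<open>s > 0\<close> by simp
  moreover have "(\<Sum>p\<in>P. u p / s) = 1 / s" by (simp add: sum_divide_distrib[symmetric] u(2))
  moreover have "\<bar>((1 / b) *\<^sub>R a) \<bullet> p\<bar> \<le> 1" if "p \<in> P" for p
    using absP[OF that] \<open>b > 0\<close> by (simp add: abs_mult)
  ultimately show ?thesis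
    using av \<open>s > 0\<close> u(1) by (intro exI[of _ "(1 / b) *\<^sub>R a"] exI[of _ "\<lambda>p. u p / s"]) auto
qed

lemma word_with_counts:
  assumes "finite A" and "A \<subseteq> P"
  shows "\<exists>w. set w \<subseteq> P \<and> sum_list w = (\<Sum>p\<in>A. real (n p) *\<^sub>R p) \<and> length w = sum n A"
  using assms
proof (induction A rule: finite_induct)
  case empty
  then show ?case by (intro exI[of _ "[]"]) auto
next
  case (insert p A)
  then obtain w where "set w \<subseteq> P" "sum_list w = (\<Sum>p\<in>A. real (n p) *\<^sub>R p)" "length w = sum n A" by auto
  then show ?case using insert
    by (intro exI[of _ "replicate (n p) p @ w"]) (auto simp: sum_list_replicate_vec set_replicate_conv_if)
qed

text \<open>Rounding down the coefficients from \<open>norm_functional\<close> gives a word whose sum is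
  \<open>v\<close> up to a bounded integer vector. The bound by \<open>C\<close> holds since each
  coordinate of \<open>a\<close> is at most the number of steps needed to reach that unit vector.\<close>

lemma short_word:
  "\<exists>E C::real. E \<ge> 0 \<and> C \<ge> 0 \<and> (\<forall>v\<in>integer_points. v \<noteq> 0 \<longrightarrow> (\<exists>a u. (\<forall>p\<in>P. \<bar>a \<bullet> p\<bar> \<le> 1) \<and> 0 < a \<bullet> v \<and>
    a \<bullet> v \<le> C * norm v \<and> set u \<subseteq> P \<and> sum_list u = v \<and> length u \<le> a \<bullet> v + E))"
proof -
  let ?c = "real (card P)"
  obtain E where E: "\<And>v. v \<in> integer_points \<Longrightarrow> norm v \<le> ?c * radius \<Longrightarrow>
      \<exists>e. set e \<subseteq> P \<and> sum_list e = v \<and> length e \<le> E"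
    using bounded_reach by meson
  obtain w1 w2 where w1: "set w1 \<subseteq> P" "sum_list w1 = (1, 0)" and w2: "set w2 \<subseteq> P" "sum_list w2 = (0, 1)"
    using reach integer_points_units by metis
  define C where "C = real (length w1 + length w2)"
  have "\<exists>a u. (\<forall>p\<in>P. \<bar>a \<bullet> p\<bar> \<le> 1) \<and> 0 < a \<bullet> v \<and>
    a \<bullet> v \<le> C * norm v \<and> set u \<subseteq> P \<and> sum_list u = v \<and> length u \<le> a \<bullet> v + real E"
    if v: "v \<in> integer_points" "v \<noteq> 0" for v
  proof -
    obtain a c where a: "\<And>p. p \<in> P \<Longrightarrow> \<bar>a \<bullet> p\<bar> \<le> 1" "a \<bullet> v > 0"
      and c: "\<And>p. p \<in> P \<Longrightarrow> c p \<ge> 0" "(\<Sum>p\<in>P. c p *\<^sub>R p) = v" "sum c P = a \<bullet> v"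
      using norm_functional[OF v] by blast
    have ab: "\<bar>fst a\<bar> \<le> length w1" "\<bar>snd a\<bar> \<le> length w2"
      using inner_sum_list_le[OF w1(1) a(1)] inner_sum_list_le[OF w2(1) a(1)]
      unfolding w1(2) w2(2) by (simp_all add: inner_prod_def)
    have prod_le: "x * y \<le> X * Y" if "\<bar>x\<bar> \<le> X" "\<bar>y\<bar> \<le> Y" for x y X Y :: real
    proof -
      have "\<bar>x\<bar> * \<bar>y\<bar> \<le> X * Y" using that by (intro mult_mono) auto
      then show ?thesis using abs_ge_self[of "x * y"] by (simp add: abs_mult)
    qed
    have "\<bar>fst v\<bar> \<le> norm v" "\<bar>snd v\<bar> \<le> norm v"
      using norm_fst_le[of "fst v" "snd v"] norm_snd_le[of "snd v" "fst v"] by simp_all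
    from prod_le[OF ab(1) this(1)] prod_le[OF ab(2) this(2)]
    have aC: "a \<bullet> v \<le> C * norm v" by (simp add: inner_prod_def C_def algebra_simps)
    define n where "n p = nat \<lfloor>c p\<rfloor>" for p
    have n: "real (n p) \<le> c p" "c p \<le> real (n p) + 1" if "p \<in> P" for p
      using c(1)[OF that] unfolding n_def by linarith+
    obtain u where u: "set u \<subseteq> P" "sum_list u = (\<Sum>p\<in>P. real (n p) *\<^sub>R p)" "length u = sum n P"
      using word_with_counts[OF finite_P order_refl] by blast
    have "v - sum_list u = (\<Sum>p\<in>P. (c p - real (n p)) *\<^sub>R p)"
      using c(2) u(2) by (simp add: scaleR_diff_left sum_subtractf)
    also have "norm \<dots> \<le> (\<Sum>p\<in>P. 1 * radius)"
    proof (rule sum_norm_le)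
      fix p assume "p \<in> P"
      then show "norm ((c p - real (n p)) *\<^sub>R p) \<le> 1 * radius"
        using n[of p] norm_le_radius[of p] unfolding norm_scaleR by (intro mult_mono) auto
    qed
    finally have "norm (v - sum_list u) \<le> ?c * radius" by simp
    moreover have "v - sum_list u \<in> integer_points"
      using integer_points_add[OF v(1) integer_points_minus[OF sum_list_integer[OF u(1)]]] by simp
    ultimately obtain e where e: "set e \<subseteq> P" "sum_list e = v - sum_list u" "length e \<le> E" using E by blast
    have "real (length u) \<le> sum c P" unfolding u(3) of_nat_sum by (intro sum_mono n)
    then have "real (length (u @ e)) \<le> a \<bullet> v + E" using e(3) c(3) by simp
    then show ?thesis using a aC u(1) e(1,2)
      by (intro exI[of _ a] exI[of _ "u @ e"]) auto
  qed
  moreover have "C \<ge> 0" by (simp add: C_def)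
  ultimately show ?thesis by (intro exI[of _ "real E"] exI[of _ C]) auto
qed

section \<open>An isoperimetric estimate and displaced endpoints\<close>

text \<open>Any position of a closed path may serve as its start. With the start at \<open>b\<close>, where \<open>\<psi> = wedge _ v\<close> is
  smallest, and the cut between \<open>q1\<close> and \<open>q2\<close> at \<open>i\<close>, where it is largest, \<open>wedge (sum_list q1) v\<close> is
  the width \<open>W\<close> of the path across the direction \<open>v\<close>. In the coordinates \<open>\<psi>\<close> and \<open>\<phi> = a \<bullet> _\<close>,
  partial summation turns \<open>(a \<bullet> v) * area w\<close> into the sum of \<open>(\<psi> k + \<psi> (k + 1)) \<Delta>\<phi> k\<close>. As the \<open>\<Delta>\<phi> k\<close>
  add up to zero, \<open>\<psi>\<close> may be measured from the middle of its range, and then each term is at most \<open>W\<close>.\<close>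

lemma wide_rotation:
  assumes w: "set w \<subseteq> P" and closed: "sum_list w = 0"
    and a: "\<And>p. p \<in> P \<Longrightarrow> \<bar>a \<bullet> p\<bar> \<le> 1"
  shows "\<exists>q1 q2. set (q1 @ q2) \<subseteq> P \<and> sum_list (q1 @ q2) = 0 \<and> length (q1 @ q2) = length w \<and>
    area (q1 @ q2) = area w \<and> 0 \<le> wedge (sum_list q1) v \<and>
    (a \<bullet> v) * area w \<le> length w * wedge (sum_list q1) v"
proof -
  let ?L = "length w"
  define \<psi> where "\<psi> k = wedge (sum_list (take k w)) v" for k
  define \<phi> where "\<phi> k = a \<bullet> sum_list (take k w)" for k
  have step: "\<psi> (Suc k) - \<psi> k = wedge (w ! k) v" "\<phi> (Suc k) - \<phi> k = a \<bullet> (w ! k)" if "k < ?L" for k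
    using that by (auto simp: \<psi>_def \<phi>_def sum_list_take_Suc wedge_add inner_add_right)
  define hi lo where "hi = Max (\<psi> ` {..?L})" and "lo = Min (\<psi> ` {..?L})"
  have "hi \<in> \<psi> ` {..?L}" "lo \<in> \<psi> ` {..?L}"
    unfolding hi_def lo_def by (rule Max_in Min_in; simp)+
  then obtain i b where i: "i \<le> ?L" "\<psi> i = hi" and b: "b \<le> ?L" "\<psi> b = lo"
    by (metis (no_types) atMost_iff imageE)
  have bounds: "\<psi> b \<le> \<psi> k" "\<psi> k \<le> \<psi> i" if "k \<le> ?L" for k
    unfolding i(2) b(2) hi_def lo_def using that by (simp_all add: Max_ge Min_le)
  have split: "(\<Sum>k<?L. f k + c * g k - h k) = sum f {..<?L} + c * sum g {..<?L} - sum h {..<?L}"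
    for f g h :: "nat \<Rightarrow> real" and c
    by (simp add: sum.distrib sum_subtractf sum_distrib_left)
  have "(a \<bullet> v) * area w = (\<Sum>k<?L. wedge (sum_list (take k w)) (w ! k) * (a \<bullet> v))"
    unfolding area_eq_sum by (simp add: sum_distrib_left mult.commute)
  also have "\<dots> = (\<Sum>k<?L. (\<psi> k + \<psi> (Suc k) - (\<psi> i + \<psi> b)) * (a \<bullet> (w ! k))
      + (\<psi> i + \<psi> b) * (\<phi> (Suc k) - \<phi> k) - (\<phi> (Suc k) * \<psi> (Suc k) - \<phi> k * \<psi> k))"
  proof (rule sum.cong[OF HOL.refl])
    fix k assume "k \<in> {..<?L}"
    then have k: "k < ?L" by simp
    have "wedge (sum_list (take k w)) (w ! k) * (a \<bullet> v)
      = \<psi> k * (\<phi> (Suc k) - \<phi> k) - \<phi> k * (\<psi> (Suc k) - \<psi> k)"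
      unfolding step[OF k] by (subst wedge_coordinates) (simp add: \<psi>_def \<phi>_def)
    also have "\<dots> = (\<psi> k + \<psi> (Suc k) - (\<psi> i + \<psi> b)) * (\<phi> (Suc k) - \<phi> k)
      + (\<psi> i + \<psi> b) * (\<phi> (Suc k) - \<phi> k) - (\<phi> (Suc k) * \<psi> (Suc k) - \<phi> k * \<psi> k)"
      by (simp add: algebra_simps)
    finally show "wedge (sum_list (take k w)) (w ! k) * (a \<bullet> v) =
      (\<psi> k + \<psi> (Suc k) - (\<psi> i + \<psi> b)) * (a \<bullet> (w ! k))
      + (\<psi> i + \<psi> b) * (\<phi> (Suc k) - \<phi> k) - (\<phi> (Suc k) * \<psi> (Suc k) - \<phi> k * \<psi> k)"
      by (simp only: step(2)[OF k])
  qed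
  also have "\<dots> = (\<Sum>k<?L. (\<psi> k + \<psi> (Suc k) - (\<psi> i + \<psi> b)) * (a \<bullet> (w ! k)))
      + (\<psi> i + \<psi> b) * (\<phi> ?L - \<phi> 0) - (\<phi> ?L * \<psi> ?L - \<phi> 0 * \<psi> 0)"
    unfolding split sum_lessThan_telescope[of \<phi>] sum_lessThan_telescope[of "\<lambda>k. \<phi> k * \<psi> k"] ..
  also have "\<dots> = (\<Sum>k<?L. (\<psi> k + \<psi> (Suc k) - (\<psi> i + \<psi> b)) * (a \<bullet> (w ! k)))"
    using closed by (simp add: \<phi>_def)
  also have "\<dots> \<le> (\<Sum>k<?L. (\<psi> i - \<psi> b) * 1)"
  proof (rule sum_mono)
    fix k assume "k \<in> {..<?L}"
    then have k: "k < ?L" by simp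
    have "\<bar>\<psi> k + \<psi> (Suc k) - (\<psi> i + \<psi> b)\<bar> \<le> \<psi> i - \<psi> b"
      using bounds[of k] bounds[of "Suc k"] k by auto
    moreover have "\<bar>a \<bullet> (w ! k)\<bar> \<le> 1" using a[of "w ! k"] w nth_mem[OF k] by blast
    ultimately have "\<bar>(\<psi> k + \<psi> (Suc k) - (\<psi> i + \<psi> b)) * (a \<bullet> (w ! k))\<bar> \<le> (\<psi> i - \<psi> b) * 1"
      unfolding abs_mult by (intro mult_mono) auto
    then show "(\<psi> k + \<psi> (Suc k) - (\<psi> i + \<psi> b)) * (a \<bullet> (w ! k)) \<le> (\<psi> i - \<psi> b) * 1" by linarith
  qed
  finally have main: "(a \<bullet> v) * area w \<le> ?L * (\<psi> i - \<psi> b)" by simp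
  have "\<exists>q1 q2. set (q1 @ q2) \<subseteq> P \<and> sum_list (q1 @ q2) = 0 \<and> length (q1 @ q2) = length w \<and>
    area (q1 @ q2) = area w \<and> wedge (sum_list q1) v = \<psi> i - \<psi> b"
  proof (cases "b \<le> i")
    case True
    define x q y where "x = take b w" and "q = drop b (take i w)" and "y = drop i w"
    have xq: "take i w = x @ q"
      using append_take_drop_id[of b "take i w"] True by (simp add: x_def q_def min_absorb1)
    have "w = take i w @ y" by (simp add: y_def)
    then have eq: "w = x @ q @ y" unfolding xq by simp
    have "wedge (sum_list q) v = \<psi> i - \<psi> b" unfolding \<psi>_def xq by (simp add: wedge_add x_def)
    moreover have "area (q @ y @ x) = area w" using area_rotate[of x "q @ y"] closed by (simp add: eq)
    moreover have "sum_list (q @ y @ x) = 0" using closed by (simp add: eq add_ac)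
    ultimately show ?thesis using w by (intro exI[of _ q] exI[of _ "y @ x"]) (auto simp: eq)
  next
    case False
    \<comment> \<open>Here the cut comes before the start, so \<open>q1\<close> runs through the end of \<open>w\<close>.\<close>
    define x q y where "x = take i w" and "q = drop i (take b w)" and "y = drop b w"
    have xq: "take b w = x @ q"
      using append_take_drop_id[of i "take b w"] False by (simp add: x_def q_def min_absorb1)
    have "w = take b w @ y" by (simp add: y_def)
    then have eq: "w = x @ q @ y" unfolding xq by simp
    have yxq: "sum_list (y @ x) + sum_list q = 0" using closed by (simp add: eq add_ac)
    then have "sum_list (y @ x) = - sum_list q" by (simp add: eq_neg_iff_add_eq_0)
    then have "wedge (sum_list (y @ x)) v = \<psi> i - \<psi> b" unfolding \<psi>_def xq by (simp add: wedge_add x_def)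
    moreover have "area (y @ x @ q) = area w" using area_rotate[of "x @ q" y] closed by (simp add: eq add_ac)
    ultimately show ?thesis using w yxq
      by - (rule exI[of _ "y @ x"], rule exI[of _ q], auto simp: eq add.assoc)
  qed
  then obtain q1 q2 where q: "set (q1 @ q2) \<subseteq> P" "sum_list (q1 @ q2) = 0" "length (q1 @ q2) = length w"
    "area (q1 @ q2) = area w" "wedge (sum_list q1) v = \<psi> i - \<psi> b" by blast
  show ?thesis
    using q main bounds[OF i(1)] by (intro exI[of _ q1] exI[of _ q2]) auto
qed

text \<open>The combination of \<open>shrink\<close> and \<open>wide_rotation\<close>: first remove about \<open>m\<close> steps, where \<open>m\<close> is the length
  of a short word \<open>u\<close> for \<open>v\<close>, then insert \<open>u\<close> where \<open>wide_rotation\<close> cuts what remains. The hypothesis on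
  \<open>norm v\<close> makes \<open>m\<^sup>2\<close> of order \<open>L\<close>, so that all second-order terms are absorbed in \<open>K L\<close>, and the lower
  bound \<open>L0\<close> on the length ensures \<open>m \<le> L\<close>.\<close>

lemma move_endpoint:
  fixes B :: real
  assumes "B \<ge> 0"
  shows "\<exists>(K::real) (L0::real). K \<ge> 0 \<and> (\<forall>w v. set w \<subseteq> P \<longrightarrow> sum_list w = 0 \<longrightarrow> L0 \<le> real (length w) \<longrightarrow> v \<in> integer_points \<longrightarrow>
    (norm v)\<^sup>2 \<le> B * length w \<longrightarrow> 0 \<le> area w \<longrightarrow>
    (\<exists>w'. set w' \<subseteq> P \<and> sum_list w' = v \<and> length w' \<le> length w + K \<and>
      area w' \<ge> area w - K * length w))"
proof -
  obtain Ks where Ks: "Ks \<ge> 0" and shrunk: "\<And>w m. set w \<subseteq> P \<Longrightarrow> sum_list w = 0 \<Longrightarrow> m \<le> length w \<Longrightarrow>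
    (\<exists>w'. set w' \<subseteq> P \<and> sum_list w' = 0 \<and> real (length w') \<le> real (length w) - real m + Ks \<and>
       real (length w) * area w' \<ge> real (length w) * area w - 2 * real m * area w
          - Ks * real (length w) * (real (length w) + (real m)\<^sup>2))"
    using shrink by blast
  obtain E C :: real where E: "E \<ge> 0" and C: "C \<ge> 0" and short: "\<And>v. v \<in> integer_points \<Longrightarrow> v \<noteq> 0 \<Longrightarrow>
    (\<exists>a u. (\<forall>p\<in>P. \<bar>a \<bullet> p\<bar> \<le> 1) \<and> 0 < a \<bullet> v \<and>
    a \<bullet> v \<le> C * norm v \<and> set u \<subseteq> P \<and> sum_list u = v \<and> length u \<le> a \<bullet> v + E)"
    using short_word by blast
  define G where "G = 2 * C\<^sup>2 * B + 2 * E\<^sup>2"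
  define H where "H = 2 * radius\<^sup>2 * E + 4 * radius\<^sup>2 * G + Ks * (1 + G) + 2 * radius\<^sup>2 * Ks"
  define K where "K = Ks + Ks * (1 + G) + 2 * radius\<^sup>2 * G + 2 * H"
  have G0: "G \<ge> 0" using \<open>B \<ge> 0\<close> by (simp add: G_def)
  have H0: "H \<ge> 0" unfolding H_def using G0 E Ks by (intro add_nonneg_nonneg mult_nonneg_nonneg) auto
  have K0: "K \<ge> 0" and KKs: "K \<ge> Ks" unfolding K_def using G0 H0 Ks
    by (auto intro!: add_nonneg_nonneg mult_nonneg_nonneg)
  have "\<exists>w'. set w' \<subseteq> P \<and> sum_list w' = v \<and> length w' \<le> length w + K \<and> area w' \<ge> area w - K * length w"
    if w: "set w \<subseteq> P" and closed: "sum_list w = 0" and len: "max 1 G \<le> real (length w)"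
      and v: "v \<in> integer_points" and vB: "(norm v)\<^sup>2 \<le> B * length w" and area0: "0 \<le> area w" for w v
  proof (cases "v = 0")
    case True
    then show ?thesis using w closed K0 by (intro exI[of _ w]) auto
  next
    case False
    define L where "L = real (length w)"
    have L1: "L \<ge> 1" and LG: "L \<ge> G" using len by (auto simp: L_def)
    obtain a u where a: "\<And>p. p \<in> P \<Longrightarrow> \<bar>a \<bullet> p\<bar> \<le> 1" "0 < a \<bullet> v" "a \<bullet> v \<le> C * norm v"
      and u: "set u \<subseteq> P" "sum_list u = v" "length u \<le> a \<bullet> v + E" using short[OF v False] by blast
    define N m A where "N = a \<bullet> v" and "m = real (length u)" and "A = area w"
    have A0: "A \<ge> 0" using area0 by (simp add: A_def)
    have N0: "N \<ge> 0" and m0: "m \<ge> 0" using a by (auto simp: N_def m_def)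
    have mN: "m \<le> N + E" using u(3) by (simp add: m_def N_def)
    have AL: "A \<le> 2 * radius\<^sup>2 * L\<^sup>2" using area_word_le[OF w] by (simp add: A_def L_def)
    have "N\<^sup>2 \<le> (C * norm v)\<^sup>2" using a N0 by (intro power_mono) (auto simp: N_def)
    also have "\<dots> \<le> C\<^sup>2 * (B * L)" using vB by (simp add: power_mult_distrib mult_left_mono L_def)
    finally have N2: "N\<^sup>2 \<le> C\<^sup>2 * B * L" by (simp add: mult.assoc)
    have m2: "m\<^sup>2 \<le> G * L"
    proof -
      have "m\<^sup>2 \<le> (N + E)\<^sup>2" using mN m0 by (rule power_mono)
      also have "\<dots> \<le> 2 * N\<^sup>2 + 2 * E\<^sup>2" using sum_squares_bound[of N E] by (simp add: power2_sum)
      also have "\<dots> \<le> 2 * (C\<^sup>2 * B * L) + 2 * E\<^sup>2 * L"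
        using N2 L1 mult_left_mono[of 1 L "2 * E\<^sup>2"] by simp
      finally show ?thesis by (simp add: G_def algebra_simps)
    qed
    have N2': "N\<^sup>2 \<le> G * L"
    proof -
      have "C\<^sup>2 * B * L \<le> G * L" using \<open>B \<ge> 0\<close> L1 by (intro mult_right_mono) (auto simp: G_def)
      then show ?thesis using N2 by linarith
    qed
    have GLL: "G * L \<le> L\<^sup>2" using LG L1 by (simp add: power2_eq_square mult_right_mono)
    have mL: "m \<le> L" using m2 GLL L1 by (intro power2_le_imp_le[of m L]) auto
    have NL: "N \<le> L" using N2' GLL L1 by (intro power2_le_imp_le[of N L]) auto
    have Nm: "N * m \<le> G * L" using sum_squares_bound[of N m] N2' m2 by simp
    have "length u \<le> length w" using mL by (simp add: m_def L_def)
    from shrunk[OF w closed this] obtain w2 where w2: "set w2 \<subseteq> P" "sum_list w2 = 0"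
      "length w2 \<le> L - m + Ks" "L * area w2 \<ge> L * A - 2 * m * A - Ks * L * (L + m\<^sup>2)"
      unfolding L_def A_def m_def by blast
    define A2 L2 where "A2 = area w2" and "L2 = real (length w2)"
    obtain q1 q2 where q: "set (q1 @ q2) \<subseteq> P" "sum_list (q1 @ q2) = 0" "length (q1 @ q2) = length w2"
      "area (q1 @ q2) = area w2" "0 \<le> wedge (sum_list q1) v" "N * A2 \<le> L2 * wedge (sum_list q1) v"
      using wide_rotation[OF w2(1,2) a(1), where v = v] unfolding A2_def L2_def N_def by blast
    define W where "W = wedge (sum_list q1) v"
    \<comment> \<open>The loss from shortening and the gain from inserting are both \<open>2 \<mu>\<close> up to \<open>O(L)\<close>.\<close>
    define \<mu> where "\<mu> = m * A / L"
    have \<mu>L: "\<mu> * L = m * A" using L1 by (simp add: \<mu>_def)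
    have \<mu>: "\<mu> \<le> 2 * radius\<^sup>2 * L * m"
    proof -
      have "m * A \<le> m * (2 * radius\<^sup>2 * L\<^sup>2)" using AL m0 by (rule mult_left_mono)
      then show ?thesis using L1 by (simp add: \<mu>_def field_simps power2_eq_square)
    qed
    have A2: "A2 \<ge> A - 2 * \<mu> - Ks * (1 + G) * L"
    proof -
      have "Ks * (L + m\<^sup>2) \<le> Ks * (L + G * L)" using m2 Ks by (intro mult_left_mono) auto
      then have "L * (Ks * (L + m\<^sup>2)) \<le> L * (Ks * (L + G * L))"
        by (rule mult_left_mono) (use L1 in simp)
      then have "L * A2 \<ge> L * (A - 2 * \<mu> - Ks * (1 + G) * L)"
        using w2(4) \<mu>L by (simp add: A2_def algebra_simps)
      then show ?thesis using L1 by (simp add: mult_le_cancel_left)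
    qed
    have "(L + Ks) * W \<ge> L2 * W" using w2(3) q(5) m0 by (intro mult_right_mono) (auto simp: L2_def W_def)
    then have "(L + Ks) * W \<ge> N * A2" using q(6) by (simp add: W_def)
    moreover have "N * A2 \<ge> N * (A - 2 * \<mu> - Ks * (1 + G) * L)" using A2 N0 by (rule mult_left_mono)
    moreover have "N * A \<ge> \<mu> * L - E * (2 * radius\<^sup>2 * L\<^sup>2)"
    proof -
      have "N * A \<ge> (m - E) * A" using mN A0 by (intro mult_right_mono) auto
      moreover have "E * A \<le> E * (2 * radius\<^sup>2 * L\<^sup>2)" using AL E by (rule mult_left_mono)
      ultimately show ?thesis unfolding \<mu>L left_diff_distrib by linarith
    qed
    moreover have "N * \<mu> \<le> 2 * radius\<^sup>2 * G * L\<^sup>2"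
    proof -
      have "N * \<mu> \<le> N * (2 * radius\<^sup>2 * L * m)" using \<mu> N0 by (rule mult_left_mono)
      also have "\<dots> = (2 * radius\<^sup>2 * L) * (N * m)" by (simp add: algebra_simps)
      also have "\<dots> \<le> (2 * radius\<^sup>2 * L) * (G * L)" using Nm L1 by (intro mult_left_mono) auto
      finally show ?thesis by (simp add: power2_eq_square algebra_simps)
    qed
    moreover have "N * (Ks * (1 + G) * L) \<le> Ks * (1 + G) * L\<^sup>2"
    proof -
      have "N * (Ks * (1 + G) * L) \<le> L * (Ks * (1 + G) * L)" using NL Ks G0 L1 by (intro mult_right_mono) auto
      then show ?thesis by (simp add: power2_eq_square algebra_simps)
    qed
    ultimately have W1: "(L + Ks) * W \<ge> \<mu> * L - (2 * radius\<^sup>2 * E + 4 * radius\<^sup>2 * G + Ks * (1 + G)) * L\<^sup>2"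
      by (simp add: algebra_simps)
    have W: "W \<ge> \<mu> - H * L"
    proof -
      have "Ks * \<mu> \<le> Ks * (2 * radius\<^sup>2 * L * L)"
        using \<mu> mult_left_mono[OF mL, of "2 * radius\<^sup>2 * L"] L1 Ks by (intro mult_left_mono) auto
      moreover have "Ks * (H * L) \<ge> 0" using Ks H0 L1 by simp
      ultimately have "(L + Ks) * (\<mu> - H * L) \<le> \<mu> * L - (2 * radius\<^sup>2 * E + 4 * radius\<^sup>2 * G + Ks * (1 + G)) * L\<^sup>2"
        by (simp add: H_def algebra_simps power2_eq_square)
      then have "(L + Ks) * (\<mu> - H * L) \<le> (L + Ks) * W" using W1 by linarith
      moreover have "L + Ks > 0" using L1 Ks by linarith
      ultimately show ?thesis by (simp add: mult_le_cancel_left)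
    qed
    have area_u: "area u \<ge> - (2 * radius\<^sup>2 * G * L)"
    proof -
      have "\<bar>area u\<bar> \<le> 2 * radius\<^sup>2 * m\<^sup>2" using area_word_le[OF u(1)] by (simp add: m_def)
      also have "\<dots> \<le> 2 * radius\<^sup>2 * (G * L)" using m2 by (intro mult_left_mono) auto
      finally show ?thesis by (simp add: algebra_simps)
    qed
    have "area (q1 @ u @ q2) = A2 + area u + 2 * W"
      using area_insert[OF q(2), of u] q(4) u(2) by (simp add: A2_def W_def)
    then have "area (q1 @ u @ q2) \<ge> A - (Ks * (1 + G) + 2 * radius\<^sup>2 * G + 2 * H) * L"
      using A2 area_u W by (simp add: algebra_simps)
    moreover have "(Ks * (1 + G) + 2 * radius\<^sup>2 * G + 2 * H) * L \<le> K * L"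
      using Ks L1 by (intro mult_right_mono) (auto simp: K_def)
    ultimately have "area (q1 @ u @ q2) \<ge> A - K * L" by linarith
    moreover have "real (length (q1 @ u @ q2)) \<le> L + K"
    proof -
      have "real (length (q1 @ u @ q2)) = real (length w2) + m" using q(3) by (simp add: m_def)
      then show ?thesis using w2(3) KKs by linarith
    qed
    moreover have "sum_list (q1 @ u @ q2) = v"
    proof -
      have "sum_list (q1 @ u @ q2) = v + (sum_list q1 + sum_list q2)" using u(2) by simp
      then show ?thesis using q(2) by simp
    qed
    moreover have "set (q1 @ u @ q2) \<subseteq> P" using q(1) u(1) by simp
    ultimately show ?thesis unfolding A_def L_def by (intro exI[of _ "q1 @ u @ q2"] conjI)
  qed
  note main = this
  show ?thesis
    by (rule exI[of _ K], rule exI[of _ "max 1 G"]) (intro conjI allI impI K0 main; assumption)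
qed

text \<open>Inserting \<open>p\<close> at one side of the path and \<open>- p\<close> at the other, \<open>j\<close> times each, gains \<open>2 j\<close> times the width of the path,
  which is at least a multiple of \<open>area w / L\<close> by \<open>wide_rotation\<close>. After rotation the second
  insertion takes place at the end of the path.\<close>

lemma boost_area:
  "\<exists>\<kappa>>0. \<forall>w j. set w \<subseteq> P \<longrightarrow> sum_list w = 0 \<longrightarrow>
    (\<exists>w'. set w' \<subseteq> P \<and> sum_list w' = 0 \<and> length w' = length w + 2 * j \<and>
      real (length w) * area w' \<ge> (real (length w) + \<kappa> * real j) * area w)"
proof -
  obtain w where "set w \<subseteq> P" "sum_list w = (1, 0)" using reach integer_points_units by blast
  moreover have "sum_list w = 0" if "\<forall>p\<in>set w. p = 0" for w :: "(real \<times> real) list"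
    using that by (induction w) auto
  ultimately have "\<exists>p\<in>set w. p \<noteq> 0" by (metis fst_conv fst_zero zero_neq_one)
  then obtain p where p: "p \<in> P" "p \<noteq> 0" using \<open>set w \<subseteq> P\<close> by blast
  then have "p \<in> integer_points" using P_integer by blast
  then obtain a where a: "\<And>q. q \<in> P \<Longrightarrow> \<bar>a \<bullet> q\<bar> \<le> 1" "a \<bullet> p > 0"
    using norm_functional p(2) by blast
  have "\<exists>w'. set w' \<subseteq> P \<and> sum_list w' = 0 \<and> length w' = length w + 2 * j \<and>
      real (length w) * area w' \<ge> (real (length w) + 2 * (a \<bullet> p) * real j) * area w"
    if w: "set w \<subseteq> P" and closed: "sum_list w = 0" for w j
  proof -
    obtain q1 q2 where q: "set (q1 @ q2) \<subseteq> P" "sum_list (q1 @ q2) = 0" "length (q1 @ q2) = length w"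
      "area (q1 @ q2) = area w" "0 \<le> wedge (sum_list q1) p" "(a \<bullet> p) * area w \<le> length w * wedge (sum_list q1) p"
      using wide_rotation[OF w closed a(1), where v = p] by blast
    define w' where "w' = (q1 @ replicate j p @ q2) @ replicate j (- p)"
    have q12: "sum_list q1 + sum_list q2 = 0" using q(2) by simp
    have s: "sum_list (q1 @ replicate j p @ q2) = real j *\<^sub>R p"
    proof -
      have "sum_list (q1 @ replicate j p @ q2) = real j *\<^sub>R p + (sum_list q1 + sum_list q2)"
        by (simp add: sum_list_replicate_vec)
      then show ?thesis by (simp only: q12 add_0_right)
    qed
    have "area w' = area (q1 @ replicate j p @ q2)"
      unfolding w'_def area_append[of "q1 @ replicate j p @ q2"] s by (simp add: sum_list_replicate_vec)
    also have "\<dots> = area w + 2 * real j * wedge (sum_list q1) p"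
      unfolding area_insert[OF q(2)] by (simp add: q(4) sum_list_replicate_vec)
    finally have "length w * area w' = length w * area w + 2 * real j * (length w * wedge (sum_list q1) p)"
      by (simp add: algebra_simps)
    also have "\<dots> \<ge> length w * area w + 2 * real j * ((a \<bullet> p) * area w)"
      using q(6) by (intro add_left_mono mult_left_mono) auto
    finally have "length w * area w' \<ge> (length w + 2 * (a \<bullet> p) * real j) * area w" by (simp add: algebra_simps)
    moreover have "sum_list w' = 0" unfolding w'_def sum_list_append[of "q1 @ replicate j p @ q2"] s
      by (simp add: sum_list_replicate_vec)
    moreover have "set w' \<subseteq> P" using q(1) p(1) minus_P[OF p(1)] by (auto simp: w'_def set_replicate_conv_if)
    moreover have "length w' = length w + 2 * j" using q(3) by (simp add: w'_def)
    ultimately show ?thesis by blast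
  qed
  then show ?thesis using a(2) by (intro exI[of _ "2 * (a \<bullet> p)"]) auto
qed

end

section \<open>Paths of intermediate area\<close>

text \<open>A discrete intermediate value theorem: along a chain from \<open>x\<close> to \<open>y\<close> with jumps of at most \<open>\<delta>\<close>, stop at
  the last element before \<open>f\<close> first drops below \<open>\<tau>\<close>.\<close>

lemma rtranclp_intermediate_value:
  fixes f :: "'a \<Rightarrow> real"
  assumes "r\<^sup>*\<^sup>* x y" and "\<And>u v. r u v \<Longrightarrow> \<bar>f u - f v\<bar> \<le> \<delta>" and "f y \<le> \<tau>" "\<tau> \<le> f x" and "\<delta> \<ge> 0"
  shows "\<exists>z. r\<^sup>*\<^sup>* x z \<and> \<bar>f z - \<tau>\<bar> \<le> \<delta>"
  using assms(1,4)
proof (induction rule: converse_rtranclp_induct)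
  case base
  then have "\<bar>f y - \<tau>\<bar> \<le> \<delta>" using assms(3,5) by simp
  then show ?case by blast
next
  case (step x x')
  show ?case
  proof (cases "\<tau> \<le> f x'")
    case True
    then obtain z where "r\<^sup>*\<^sup>* x' z" "\<bar>f z - \<tau>\<bar> \<le> \<delta>" using step.IH by blast
    then show ?thesis using step.hyps(1) by (meson converse_rtranclp_into_rtranclp)
  next
    case False
    then have "\<bar>f x - \<tau>\<bar> \<le> \<delta>" using assms(2)[OF step.hyps(1)] step.prems by linarith
    then show ?thesis by blast
  qed
qed

context step_set
begin

text \<open>Both exchanged steps are required to lie in \<open>P\<close> so that the change of area is bounded along every
  chain of swaps.\<close>

inductive swap :: "(real \<times> real) list \<Rightarrow> (real \<times> real) list \<Rightarrow> bool" where
  swapI: "a \<in> P \<Longrightarrow> b \<in> P \<Longrightarrow> swap (u @ a # b # v) (u @ b # a # v)"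

lemma swap_area: "swap w w' \<Longrightarrow> \<bar>area w - area w'\<bar> \<le> 4 * radius\<^sup>2"
proof (induction rule: swap.induct)
  case (swapI a b u v)
  have "area (u @ a # b # v) - area (u @ b # a # v) = 2 * wedge a b"
    using wedge_swap[of b a] by (simp add: area_append wedge_add add_ac)
  moreover have "2 * norm a * norm b \<le> 2 * radius * radius"
    using swapI norm_le_radius radius_nonneg by (intro mult_mono) auto
  ultimately show ?case using abs_wedge_le[of a b] by (simp add: power2_eq_square)
qed

lemma swap_mset: "swap w w' \<Longrightarrow> mset w' = mset w"
  by (induction rule: swap.induct) (simp add: add_mset_commute)

lemma swaps_mset: "swap\<^sup>*\<^sup>* w w' \<Longrightarrow> mset w' = mset w"
  by (induction rule: rtranclp_induct) (simp_all add: swap_mset)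

lemma swaps_Cons: "swap\<^sup>*\<^sup>* w w' \<Longrightarrow> swap\<^sup>*\<^sup>* (c # w) (c # w')"
proof (induction rule: rtranclp_induct)
  case (step y z)
  have "swap (c # y) (c # z)"
    using step.hyps(2) by (cases rule: swap.cases) (metis append_Cons swap.intros)
  then show ?case using step.IH by simp
qed simp

lemma swaps_snoc: "swap\<^sup>*\<^sup>* w w' \<Longrightarrow> swap\<^sup>*\<^sup>* (w @ [c]) (w' @ [c])"
proof (induction rule: rtranclp_induct)
  case (step y z)
  have "swap (y @ [c]) (z @ [c])"
    using step.hyps(2) by (cases rule: swap.cases) (metis append_Cons append_assoc swap.intros)
  then show ?case using step.IH by simp
qed simp

lemma swaps_to_end: "a \<in> P \<Longrightarrow> set w \<subseteq> P \<Longrightarrow> swap\<^sup>*\<^sup>* (a # w) (w @ [a])"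
proof (induction w)
  case (Cons b w)
  have "swap (a # b # w) (b # a # w)" using swap.intros[of a b "[]" w] Cons.prems by simp
  moreover have "swap\<^sup>*\<^sup>* (b # a # w) (b # w @ [a])" using Cons by (intro swaps_Cons) auto
  ultimately show ?case by simp
qed simp

lemma swaps_rev: "set w \<subseteq> P \<Longrightarrow> swap\<^sup>*\<^sup>* w (rev w)"
proof (induction w)
  case (Cons a w)
  then have "swap\<^sup>*\<^sup>* (a # w) (w @ [a])" by (intro swaps_to_end) auto
  also have "swap\<^sup>*\<^sup>* (w @ [a]) (rev w @ [a])" using Cons by (intro swaps_snoc) auto
  finally show ?case by simp
qed simp

lemma area_interpolation:
  assumes "set w \<subseteq> P" and "- area w \<le> \<tau>" and "\<tau> \<le> area w"
  shows "\<exists>w'. mset w' = mset w \<and> \<bar>area w' - \<tau>\<bar> \<le> 4 * radius\<^sup>2"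
proof -
  have "\<exists>z. swap\<^sup>*\<^sup>* w z \<and> \<bar>area z - \<tau>\<bar> \<le> 4 * radius\<^sup>2"
    using rtranclp_intermediate_value[OF swaps_rev[OF assms(1)], of area] swap_area assms(2,3)
    by (simp add: area_rev)
  then show ?thesis using swaps_mset by blast
qed

end

section \<open>Coordinates on the Heisenberg group\<close>

interpretation H3: group H3 by (rule group_H3)

lemma carrier_H3 [simp]: "carrier H3 = UNIV" and mult_H3: "(\<otimes>\<^bsub>H3\<^esub>) = heis_mult" and one_H3: "\<one>\<^bsub>H3\<^esub> = heis_one"
  by (simp_all add: H3_def)

text \<open>Applied with \<open>u = v\<close> this says that powers commute with whatever commutes with the base; applied
  with \<open>v\<close> a conjugate of \<open>u\<close> it moves an element past a power.\<close>

lemma (in group) intertwine_int_pow: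
  assumes "y \<in> carrier G" "u \<in> carrier G" "v \<in> carrier G" and "y \<otimes> u = v \<otimes> y"
  shows "y \<otimes> u [^] (a::int) = v [^] a \<otimes> y"
proof -
  have nat: "y \<otimes> u [^] n = v [^] n \<otimes> y" for n :: nat
  proof (induction n)
    case (Suc n)
    have "y \<otimes> u [^] Suc n = (y \<otimes> u [^] n) \<otimes> u" using assms by (simp add: m_assoc)
    also have "\<dots> = v [^] n \<otimes> (y \<otimes> u)" using assms Suc by (simp add: m_assoc)
    also have "\<dots> = v [^] Suc n \<otimes> y" using assms by (simp add: m_assoc)
    finally show ?case .
  qed (use assms in simp)
  have inverse: "y \<otimes> inv (u [^] n) = inv (v [^] n) \<otimes> y" for n :: nat
  proof -
    have "v [^] n \<otimes> (y \<otimes> inv (u [^] n)) = (y \<otimes> u [^] n) \<otimes> inv (u [^] n)"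
      unfolding nat using assms by (simp add: m_assoc)
    also have "\<dots> = y" using assms by (simp add: m_assoc)
    finally have e: "y = v [^] n \<otimes> (y \<otimes> inv (u [^] n))" by (rule HOL.sym)
    show ?thesis by (rule inv_solve_left[THEN iffD2, OF _ _ _ e]) (use assms in auto)
  qed
  show ?thesis
  proof (cases "a < 0")
    case True
    then show ?thesis unfolding int_pow_def2 if_P[OF True] by (intro inverse)
  next
    case False
    then show ?thesis unfolding int_pow_def2 if_not_P[OF False] by (intro nat)
  qed
qed

fun letter_vec :: "letter \<Rightarrow> real \<times> real" where
  "letter_vec (Gen_x, False) = (1, 0)"
| "letter_vec (Gen_x, True) = (- 1, 0)"
| "letter_vec (Gen_y, False) = (0, 1)"
| "letter_vec (Gen_y, True) = (0, - 1)"

lemma letter_vec_inv: "letter_vec (inv_letter a) = - letter_vec a"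
  by (cases a rule: letter_vec.cases) (auto simp: inv_letter_def)

lemma comm_word_eq: "comm_word = [(Gen_x, False), (Gen_y, False), (Gen_x, True), (Gen_y, True)]"
  by (simp add: comm_word_def inv_word_def inv_letter_def)

lemma comm_word_sum: "sum_list (map letter_vec comm_word) = 0"
  and comm_word_area: "area (map letter_vec comm_word) = 2"
  by (simp_all add: comm_word_eq zero_prod_def wedge_def)

text \<open>The endpoint and the area of the path drawn by a word in \<open>x\<close> and \<open>y\<close> respect the defining relations:
  backtracking encloses nothing, and \<open>[x,y]\<close> draws a closed unit square, whose area is added
  wherever the square is inserted.\<close>

lemma heis_eq_invariants:
  "heis_eq u v \<Longrightarrow> sum_list (map letter_vec u) = sum_list (map letter_vec v) \<and>
     area (map letter_vec u) = area (map letter_vec v)"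
  by (induction rule: heis_eq.induct)
     (auto simp: area_append comm_word_sum comm_word_area letter_vec_inv)

lift_definition horizontal :: "heis \<Rightarrow> real \<times> real" is "\<lambda>w. sum_list (map letter_vec w)"
  using heis_eq_invariants by blast

lift_definition height :: "heis \<Rightarrow> real" is "\<lambda>w. area (map letter_vec w)"
  using heis_eq_invariants by blast

lemma horizontal_mult [simp]: "horizontal (g \<otimes>\<^bsub>H3\<^esub> h) = horizontal g + horizontal h"
  unfolding mult_H3 by transfer simp

lemma height_mult [simp]: "height (g \<otimes>\<^bsub>H3\<^esub> h) = height g + height h + wedge (horizontal g) (horizontal h)"
  unfolding mult_H3 by transfer (simp add: area_append)

lemma horizontal_one [simp]: "horizontal \<one>\<^bsub>H3\<^esub> = 0" and height_one [simp]: "height \<one>\<^bsub>H3\<^esub> = 0"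
  unfolding one_H3 by (transfer, simp)+

lemma horizontal_inv [simp]: "horizontal (inv\<^bsub>H3\<^esub> g) = - horizontal g"
proof -
  have "horizontal (inv\<^bsub>H3\<^esub> g) + horizontal g = 0" unfolding horizontal_mult[symmetric] by (simp del: horizontal_mult)
  then show ?thesis by (simp add: eq_neg_iff_add_eq_0)
qed

lemma height_inv [simp]: "height (inv\<^bsub>H3\<^esub> g) = - height g"
proof -
  have "height (inv\<^bsub>H3\<^esub> g) + height g + wedge (horizontal (inv\<^bsub>H3\<^esub> g)) (horizontal g) = 0"
    unfolding height_mult[symmetric] by (simp del: height_mult)
  then show ?thesis by simp
qed

lemma horizontal_nat_pow: "horizontal (g [^]\<^bsub>H3\<^esub> (n::nat)) = real n *\<^sub>R horizontal g"
  by (induction n) (simp_all only: H3.nat_pow_0 H3.nat_pow_Suc horizontal_one horizontal_mult of_nat_0 of_nat_Suc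
      scaleR_zero_left scaleR_add_left scaleR_one add.commute)

lemma height_nat_pow: "height (g [^]\<^bsub>H3\<^esub> (n::nat)) = real n * height g"
proof (induction n)
  case (Suc n)
  have "height (g [^]\<^bsub>H3\<^esub> Suc n) = height (g [^]\<^bsub>H3\<^esub> n) + height g"
    by (simp add: horizontal_nat_pow)
  also have "\<dots> = real (Suc n) * height g" unfolding Suc by (simp add: distrib_right)
  finally show ?case .
qed simp

lemma horizontal_int_pow [simp]: "horizontal (g [^]\<^bsub>H3\<^esub> (n::int)) = real_of_int n *\<^sub>R horizontal g"
  and height_int_pow [simp]: "height (g [^]\<^bsub>H3\<^esub> (n::int)) = real_of_int n * height g"
proof -
  have "horizontal (g [^]\<^bsub>H3\<^esub> n) = real_of_int n *\<^sub>R horizontal g \<and> height (g [^]\<^bsub>H3\<^esub> n) = real_of_int n * height g"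
  proof (cases "n < 0")
    case True
    then show ?thesis
      unfolding int_pow_def2 if_P[OF True] horizontal_inv height_inv horizontal_nat_pow height_nat_pow by simp
  next
    case False
    then show ?thesis unfolding int_pow_def2 if_not_P[OF False] horizontal_nat_pow height_nat_pow by simp
  qed
  then show "horizontal (g [^]\<^bsub>H3\<^esub> n) = real_of_int n *\<^sub>R horizontal g"
    "height (g [^]\<^bsub>H3\<^esub> n) = real_of_int n * height g" by blast+
qed

lemma letter_vec_sum_integer: "sum_list (map letter_vec w) \<in> integer_points"
  and letter_vec_integer: "letter_vec a \<in> integer_points"
proof -
  show l: "letter_vec a \<in> integer_points" for a
    by (cases a rule: letter_vec.cases) (auto simp: integer_points_def)
  have "0 \<in> integer_points" by (simp add: integer_points_def zero_prod_def)
  then show "sum_list (map letter_vec w) \<in> integer_points"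
    by (induction w) (simp_all add: l integer_points_add)
qed

lemma horizontal_integer: "horizontal g \<in> integer_points"
  by transfer (rule letter_vec_sum_integer)

lemma height_Ints: "height g \<in> \<int>"
proof transfer
  fix w
  have "wedge u v \<in> \<int>" if "u \<in> integer_points" "v \<in> integer_points" for u v
    using that by (auto simp: integer_points_def wedge_def)
  then show "area (map letter_vec w) \<in> \<int>"
    by (induction w) (simp_all add: letter_vec_integer letter_vec_sum_integer)
qed

lemma horizontal_x [simp]: "horizontal heis_x = (1, 0)" and horizontal_y [simp]: "horizontal heis_y = (0, 1)"
  and height_x [simp]: "height heis_x = 0" and height_y [simp]: "height heis_y = 0"
  by (transfer, simp)+

definition heis_z :: heis where "heis_z = commutator H3 heis_x heis_y"

lemma horizontal_z [simp]: "horizontal heis_z = 0" and height_z [simp]: "height heis_z = 2"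
  by (simp_all add: heis_z_def commutator_def wedge_def zero_prod_def)

lift_definition word_elem :: "letter list \<Rightarrow> heis" is "\<lambda>w. w" .

lemma word_elem_surj: "\<exists>w. g = word_elem w"
  by transfer (auto intro: heis_eq.refl)

lemma word_elem_append: "word_elem (u @ w) = word_elem u \<otimes>\<^bsub>H3\<^esub> word_elem w"
  unfolding mult_H3 by transfer (rule heis_eq.refl)

lemma word_elem_Nil: "word_elem [] = \<one>\<^bsub>H3\<^esub>"
  unfolding one_H3 by transfer (rule heis_eq.refl)

lemma word_elem_x: "word_elem [(Gen_x, False)] = heis_x" and word_elem_y: "word_elem [(Gen_y, False)] = heis_y"
  by (transfer, rule heis_eq.refl)+

lemma word_elem_inv: "word_elem [inv_letter a] = inv\<^bsub>H3\<^esub> (word_elem [a])"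
proof -
  have "word_elem [inv_letter a] \<otimes>\<^bsub>H3\<^esub> word_elem [a] = \<one>\<^bsub>H3\<^esub>"
    unfolding mult_H3 one_H3
  proof transfer
    fix a
    show "heis_eq ([inv_letter a] @ [a]) []" using heis_eq.cancel[of "inv_letter a"] by (simp add: inv_letter_def)
  qed
  then show ?thesis by (simp add: H3.inv_equality)
qed

lemma word_elem_x_inv: "word_elem [(Gen_x, True)] = inv\<^bsub>H3\<^esub> heis_x"
  and word_elem_y_inv: "word_elem [(Gen_y, True)] = inv\<^bsub>H3\<^esub> heis_y"
  using word_elem_inv[of "(Gen_x, False)"] word_elem_inv[of "(Gen_y, False)"]
  by (simp_all add: inv_letter_def word_elem_x word_elem_y)

lemma word_elem_comm: "word_elem comm_word = heis_z"
proof -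
  have "comm_word = [(Gen_x, False)] @ [(Gen_y, False)] @ [(Gen_x, True)] @ [(Gen_y, True)]"
    by (simp add: comm_word_eq)
  then have "word_elem comm_word = word_elem ([(Gen_x, False)] @ [(Gen_y, False)] @ [(Gen_x, True)] @ [(Gen_y, True)])"
    by (rule arg_cong)
  also have "\<dots> = heis_z"
    unfolding word_elem_append word_elem_x word_elem_y word_elem_x_inv word_elem_y_inv
      heis_z_def commutator_def by (simp add: H3.m_assoc)
  finally show ?thesis .
qed

lemma z_central: "g \<otimes>\<^bsub>H3\<^esub> heis_z = heis_z \<otimes>\<^bsub>H3\<^esub> g"
proof -
  obtain w where g: "g = word_elem w" using word_elem_surj by blast
  have "word_elem (comm_word @ w) = word_elem (w @ comm_word)" by transfer (rule heis_eq.central)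
  then show ?thesis by (simp add: g word_elem_append word_elem_comm)
qed

lemma z_pow_central: "g \<otimes>\<^bsub>H3\<^esub> heis_z [^]\<^bsub>H3\<^esub> (c::int) = heis_z [^]\<^bsub>H3\<^esub> c \<otimes>\<^bsub>H3\<^esub> g"
  by (rule H3.intertwine_int_pow) (simp_all add: z_central)

text \<open>The commutation rules are \<open>y x = (x z\<^sup>-\<^sup>1) y\<close> and \<open>y\<^sup>-\<^sup>1 x = (x z) y\<^sup>-\<^sup>1\<close>, raised to the power \<open>a\<close>; \<open>x\<close> and \<open>z\<close> commute.\<close>

lemma y_x_pow: "heis_y \<otimes>\<^bsub>H3\<^esub> heis_x [^]\<^bsub>H3\<^esub> (a::int) =
    heis_x [^]\<^bsub>H3\<^esub> a \<otimes>\<^bsub>H3\<^esub> heis_z [^]\<^bsub>H3\<^esub> (- a) \<otimes>\<^bsub>H3\<^esub> heis_y"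
  (is ?A)
  and y_inv_x_pow: "inv\<^bsub>H3\<^esub> heis_y \<otimes>\<^bsub>H3\<^esub> heis_x [^]\<^bsub>H3\<^esub> (a::int) =
    heis_x [^]\<^bsub>H3\<^esub> a \<otimes>\<^bsub>H3\<^esub> heis_z [^]\<^bsub>H3\<^esub> a \<otimes>\<^bsub>H3\<^esub> inv\<^bsub>H3\<^esub> heis_y" (is ?B)
proof -
  let ?m = "\<lambda>g h. g \<otimes>\<^bsub>H3\<^esub> h" and ?i = "\<lambda>g. inv\<^bsub>H3\<^esub> g"
  have cancel: "?m (?i g) (?m g h) = h" "?m g (?m (?i g) h) = h" for g h
    by (simp_all add: H3.m_assoc[symmetric])
  have xy: "?m heis_x heis_y = ?m heis_z (?m heis_y heis_x)"
    by (simp add: heis_z_def commutator_def H3.m_assoc cancel)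
  have zi: "?m heis_x (?i heis_z) = ?m (?i heis_z) heis_x"
    using z_pow_central[of heis_x "-1"] by (simp add: H3.int_pow_neg)
  have "?m heis_y heis_x = ?m (?i heis_z) (?m heis_x heis_y)"
    unfolding xy by (simp add: cancel)
  then have 1: "?m heis_y heis_x = ?m (?m heis_x (?i heis_z)) heis_y"
    unfolding zi by (simp add: H3.m_assoc)
  have "?m heis_y (heis_x [^]\<^bsub>H3\<^esub> a) = ?m ((?m heis_x (?i heis_z)) [^]\<^bsub>H3\<^esub> a) heis_y"
    by (rule H3.intertwine_int_pow) (simp_all add: 1)
  also have "(?m heis_x (?i heis_z)) [^]\<^bsub>H3\<^esub> a = ?m (heis_x [^]\<^bsub>H3\<^esub> a) (?i heis_z [^]\<^bsub>H3\<^esub> a)"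
    by (rule H3.int_pow_mult_distrib) (simp_all add: zi)
  also have "?i heis_z [^]\<^bsub>H3\<^esub> a = heis_z [^]\<^bsub>H3\<^esub> (- a)"
    by (simp add: H3.int_pow_neg H3.int_pow_inv)
  finally show ?A .
  have "?m heis_x heis_y = ?m (?m heis_y heis_z) heis_x"
    unfolding xy z_central[of heis_y] by (simp add: H3.m_assoc)
  also have "\<dots> = ?m heis_y (?m heis_x heis_z)"
    unfolding z_central[of heis_x] by (simp add: H3.m_assoc)
  finally have xy': "?m heis_x heis_y = ?m heis_y (?m heis_x heis_z)" .
  have "?m (?i heis_y) heis_x = ?m (?i heis_y) (?m (?m heis_x heis_y) (?i heis_y))"
    by (simp add: H3.m_assoc)
  also have "\<dots> = ?m (?m heis_x heis_z) (?i heis_y)"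
    unfolding xy' by (simp add: H3.m_assoc cancel)
  finally have 2: "?m (?i heis_y) heis_x = ?m (?m heis_x heis_z) (?i heis_y)" .
  have "?m (?i heis_y) (heis_x [^]\<^bsub>H3\<^esub> a) = ?m ((?m heis_x heis_z) [^]\<^bsub>H3\<^esub> a) (?i heis_y)"
    by (rule H3.intertwine_int_pow) (simp_all add: 2)
  also have "(?m heis_x heis_z) [^]\<^bsub>H3\<^esub> a = ?m (heis_x [^]\<^bsub>H3\<^esub> a) (heis_z [^]\<^bsub>H3\<^esub> a)"
    by (rule H3.int_pow_mult_distrib) (simp_all add: z_central)
  finally show ?B .
qed

definition normal_form :: "int \<Rightarrow> int \<Rightarrow> int \<Rightarrow> heis" where
  "normal_form a b c = heis_x [^]\<^bsub>H3\<^esub> a \<otimes>\<^bsub>H3\<^esub> (heis_y [^]\<^bsub>H3\<^esub> b \<otimes>\<^bsub>H3\<^esub> heis_z [^]\<^bsub>H3\<^esub> c)"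

lemma letter_normal_form:
  "heis_x \<otimes>\<^bsub>H3\<^esub> normal_form a b c = normal_form (1 + a) b c"
  "inv\<^bsub>H3\<^esub> heis_x \<otimes>\<^bsub>H3\<^esub> normal_form a b c = normal_form (- 1 + a) b c"
  "heis_y \<otimes>\<^bsub>H3\<^esub> normal_form a b c = normal_form a (1 + b) (- a + c)"
  "inv\<^bsub>H3\<^esub> heis_y \<otimes>\<^bsub>H3\<^esub> normal_form a b c = normal_form a (- 1 + b) (a + c)"
proof -
  let ?m = "\<lambda>g h. g \<otimes>\<^bsub>H3\<^esub> h"
  have pow1: "?m g (g [^]\<^bsub>H3\<^esub> a) = g [^]\<^bsub>H3\<^esub> (1 + a)" "?m (inv\<^bsub>H3\<^esub> g) (g [^]\<^bsub>H3\<^esub> a) = g [^]\<^bsub>H3\<^esub> (- 1 + a)" for g and a :: int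
    using H3.int_pow_mult[of g 1 a] H3.int_pow_mult[of g "- 1" a] by (simp_all add: H3.int_pow_neg)
  show "heis_x \<otimes>\<^bsub>H3\<^esub> normal_form a b c = normal_form (1 + a) b c"
    "inv\<^bsub>H3\<^esub> heis_x \<otimes>\<^bsub>H3\<^esub> normal_form a b c = normal_form (- 1 + a) b c"
    unfolding normal_form_def by (simp_all add: H3.m_assoc[symmetric] pow1)
  have gen: "?m u (normal_form a b c) = ?m (heis_x [^]\<^bsub>H3\<^esub> a) (?m (?m u (heis_y [^]\<^bsub>H3\<^esub> b)) (heis_z [^]\<^bsub>H3\<^esub> (d + c)))"
    if "?m u (heis_x [^]\<^bsub>H3\<^esub> a) = ?m (?m (heis_x [^]\<^bsub>H3\<^esub> a) (heis_z [^]\<^bsub>H3\<^esub> d)) u" for u d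
  proof -
    have "?m u (normal_form a b c) = ?m (?m u (heis_x [^]\<^bsub>H3\<^esub> a)) (?m (heis_y [^]\<^bsub>H3\<^esub> b) (heis_z [^]\<^bsub>H3\<^esub> c))"
      by (simp add: normal_form_def H3.m_assoc)
    also have "\<dots> = ?m (heis_x [^]\<^bsub>H3\<^esub> a) (?m (?m (heis_z [^]\<^bsub>H3\<^esub> d) (?m u (heis_y [^]\<^bsub>H3\<^esub> b))) (heis_z [^]\<^bsub>H3\<^esub> c))"
      unfolding that by (simp add: H3.m_assoc)
    also have "\<dots> = ?m (heis_x [^]\<^bsub>H3\<^esub> a) (?m (?m (?m u (heis_y [^]\<^bsub>H3\<^esub> b)) (heis_z [^]\<^bsub>H3\<^esub> d)) (heis_z [^]\<^bsub>H3\<^esub> c))"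
      by (simp only: z_pow_central)
    finally show ?thesis by (simp add: H3.m_assoc H3.int_pow_mult)
  qed
  show "heis_y \<otimes>\<^bsub>H3\<^esub> normal_form a b c = normal_form a (1 + b) (- a + c)"
    using gen[OF y_x_pow] unfolding pow1 normal_form_def .
  show "inv\<^bsub>H3\<^esub> heis_y \<otimes>\<^bsub>H3\<^esub> normal_form a b c = normal_form a (- 1 + b) (a + c)"
    using gen[OF y_inv_x_pow] unfolding pow1 normal_form_def .
qed

text \<open>Normal forms are stable under multiplication by letters from the left, so they exhaust the group.\<close>

lemma exists_normal_form: "\<exists>a b c. g = normal_form a b c"
proof -
  have "\<exists>a b c. word_elem w = normal_form a b c" for w
  proof (induction w)
    case Nil
    have "word_elem [] = normal_form 0 0 0" by (simp add: word_elem_Nil normal_form_def)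
    then show ?case by blast
  next
    case (Cons l w)
    then obtain a b c where w: "word_elem w = normal_form a b c" by blast
    have "word_elem (l # w) = word_elem [l] \<otimes>\<^bsub>H3\<^esub> normal_form a b c"
      using word_elem_append[of "[l]" w] by (simp add: w)
    then show ?case
      by (cases l rule: letter_vec.cases)
         (auto simp: word_elem_x word_elem_y word_elem_x_inv word_elem_y_inv letter_normal_form)
  qed
  then show ?thesis using word_elem_surj[of g] by metis
qed

text \<open>Endpoint and area are complete invariants: they are \<open>(a, b)\<close> and \<open>a b + 2 c\<close> on the normal
  form with exponents \<open>a, b, c\<close>, hence determine the exponents.\<close>

lemma heis_eqI:
  assumes "horizontal g = horizontal h" and "height g = height h"
  shows "g = h"
proof -
  have coords: "horizontal (normal_form a b c) = (of_int a, of_int b)"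
    "height (normal_form a b c) = of_int a * of_int b + 2 * of_int c" for a b c
    by (simp_all add: normal_form_def wedge_def)
  obtain a b c a' b' c' where "g = normal_form a b c" "h = normal_form a' b' c'"
    using exists_normal_form by metis
  then show ?thesis using assms by (simp add: coords)
qed

section \<open>Word length in terms of coordinates\<close>

locale heis_generators =
  fixes S :: "heis set"
  assumes finite_S: "finite S"
    and inv_S: "s \<in> S \<Longrightarrow> inv\<^bsub>H3\<^esub> s \<in> S"
    and generates: "generate H3 S = UNIV"
begin

abbreviation ev :: "heis list \<Rightarrow> heis" where "ev ws \<equiv> foldr (\<otimes>\<^bsub>H3\<^esub>) ws \<one>\<^bsub>H3\<^esub>"

abbreviation wl :: "heis \<Rightarrow> nat" where "wl \<equiv> word_length H3 S"

lemma ev_append: "ev (u @ w) = ev u \<otimes>\<^bsub>H3\<^esub> ev w"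
  by (induction u) (simp_all add: H3.m_assoc)

lemma horizontal_ev: "horizontal (ev ws) = sum_list (map horizontal ws)"
  by (induction ws) simp_all

lemma height_ev: "height (ev ws) = sum_list (map height ws) + area (map horizontal ws)"
  by (induction ws) (simp_all add: horizontal_ev)

lemma ev_surj: "\<exists>ws. set ws \<subseteq> S \<and> ev ws = g"
proof -
  have "g \<in> generate H3 S" by (simp add: generates)
  then show ?thesis
  proof (induction rule: generate.induct)
    case one
    show ?case by (intro exI[of _ "[]"]) simp
  next
    case (incl h)
    then show ?case by (intro exI[of _ "[h]"]) simp
  next
    case (inv h)
    then show ?case using inv_S by (intro exI[of _ "[inv\<^bsub>H3\<^esub> h]"]) simp
  next
    case (eng h1 h2)
    then obtain u w where "set u \<subseteq> S" "ev u = h1" "set w \<subseteq> S" "ev w = h2" by blast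
    then have "set (u @ w) \<subseteq> S" "ev (u @ w) = h1 \<otimes>\<^bsub>H3\<^esub> h2" by (auto simp only: ev_append set_append)
    then show ?case by blast
  qed
qed

lemma geodesic: "\<exists>ws. set ws \<subseteq> S \<and> length ws = wl g \<and> ev ws = g"
proof -
  obtain ws where "set ws \<subseteq> S" "ev ws = g" using ev_surj by blast
  then have "\<exists>vs. set vs \<subseteq> S \<and> length vs = length ws \<and> ev vs = g" by blast
  then show ?thesis unfolding word_length_def by (rule LeastI)
qed

lemma word_length_ev_le: "set ws \<subseteq> S \<Longrightarrow> wl (ev ws) \<le> length ws"
  unfolding word_length_def by (rule Least_le) blast

lemma word_length_mult_le: "wl (g \<otimes>\<^bsub>H3\<^esub> h) \<le> wl g + wl h"
proof -
  obtain u w where u: "set u \<subseteq> S" "length u = wl g" "ev u = g" and w: "set w \<subseteq> S" "length w = wl h" "ev w = h"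
    using geodesic by metis
  have "wl (ev (u @ w)) \<le> length (u @ w)" using u w by (intro word_length_ev_le) auto
  then show ?thesis using u w by (simp only: ev_append length_append)
qed

lemma word_length_pow_le: "wl (g [^]\<^bsub>H3\<^esub> (n::nat)) \<le> n * wl g"
proof (induction n)
  case 0
  show ?case using word_length_ev_le[of "[]"] by simp
next
  case (Suc n)
  then show ?case using word_length_mult_le[of "g [^]\<^bsub>H3\<^esub> n" g] by simp
qed

sublocale steps: step_set "horizontal ` S"
proof
  show "finite (horizontal ` S)" using finite_S by simp
  show "- p \<in> horizontal ` S" if p: "p \<in> horizontal ` S" for p
  proof -
    obtain s where "s \<in> S" "p = horizontal s" using p by blast
    then have "- p = horizontal (inv\<^bsub>H3\<^esub> s)" "inv\<^bsub>H3\<^esub> s \<in> S" using inv_S by simp_all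
    then show ?thesis by blast
  qed
  show "horizontal ` S \<subseteq> integer_points" using horizontal_integer by blast
  show "\<exists>w. set w \<subseteq> horizontal ` S \<and> sum_list w = v" if v: "v \<in> integer_points" for v
  proof -
    obtain a b where "v = (of_int a, of_int b)" using v by (auto simp: integer_points_def elim!: Ints_cases)
    then have "v = horizontal (heis_x [^]\<^bsub>H3\<^esub> a \<otimes>\<^bsub>H3\<^esub> heis_y [^]\<^bsub>H3\<^esub> b)" by simp
    moreover obtain ws where "set ws \<subseteq> S" "ev ws = heis_x [^]\<^bsub>H3\<^esub> a \<otimes>\<^bsub>H3\<^esub> heis_y [^]\<^bsub>H3\<^esub> b"
      using ev_surj by blast
    ultimately have "set (map horizontal ws) \<subseteq> horizontal ` S" "sum_list (map horizontal ws) = v"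
      by (auto simp only: horizontal_ev[symmetric] set_map image_mono)
    then show ?thesis by blast
  qed
qed

text \<open>The boundary of a \<open>k \<times> l\<close> rectangle in the generators \<open>x\<close> and \<open>y\<close> has length \<open>O(k + l)\<close> and spells
  \<open>[x,y]\<close> to the power \<open>k l\<close>. A square of side \<open>\<lfloor>\<surd>n\<rfloor>\<close> and a rectangle of height one make up \<open>n\<close>.\<close>

lemma word_length_central_le:
  "\<exists>K\<ge>1. \<forall>g n. n \<ge> 1 \<longrightarrow> horizontal g = 0 \<longrightarrow> height g = 2 * real n \<longrightarrow> real (wl g) \<le> K * sqrt (real n)"
proof -
  let ?m = "\<lambda>g h. g \<otimes>\<^bsub>H3\<^esub> h" and ?i = "\<lambda>g. inv\<^bsub>H3\<^esub> g"
  define c where "c = wl heis_x + wl heis_y + wl (?i heis_x) + wl (?i heis_y)"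
  define rect where "rect k l = ?m (?m (heis_x [^]\<^bsub>H3\<^esub> k) (heis_y [^]\<^bsub>H3\<^esub> l))
      (?m (?i heis_x [^]\<^bsub>H3\<^esub> k) (?i heis_y [^]\<^bsub>H3\<^esub> l))" for k l :: nat
  have horizontal_rect: "horizontal (rect k l) = 0" and height_rect: "height (rect k l) = 2 * real k * real l" for k l
    by (simp_all add: rect_def horizontal_nat_pow height_nat_pow wedge_def zero_prod_def)
  have wl_rect: "wl (rect k l) \<le> (k + l) * c" for k l
  proof -
    have "wl (rect k l) \<le> (wl (heis_x [^]\<^bsub>H3\<^esub> k) + wl (heis_y [^]\<^bsub>H3\<^esub> l))
        + (wl (?i heis_x [^]\<^bsub>H3\<^esub> k) + wl (?i heis_y [^]\<^bsub>H3\<^esub> l))"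
      unfolding rect_def by (intro order.trans[OF word_length_mult_le] add_mono word_length_mult_le)
    also have "\<dots> \<le> (k * wl heis_x + l * wl heis_y) + (k * wl (?i heis_x) + l * wl (?i heis_y))"
      by (intro add_mono word_length_pow_le)
    also have "\<dots> \<le> (k + l) * c" by (simp add: c_def algebra_simps)
    finally show ?thesis .
  qed
  have "real (wl g) \<le> (5 * real c + 1) * sqrt (real n)"
    if n: "n \<ge> 1" and g: "horizontal g = 0" "height g = 2 * real n" for g n
  proof -
    define k where "k = nat \<lfloor>sqrt (real n)\<rfloor>"
    have k: "real k \<le> sqrt (real n)" "sqrt (real n) < real k + 1"
    proof -
      have "real k = of_int \<lfloor>sqrt (real n)\<rfloor>" by (simp add: k_def)
      then show "real k \<le> sqrt (real n)" "sqrt (real n) < real k + 1"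
        using floor_correct[of "sqrt (real n)"] by linarith+
    qed
    have s1: "sqrt (real n) \<ge> 1" using n by simp
    have "(real k)\<^sup>2 \<le> (sqrt (real n))\<^sup>2" using k by (intro power_mono) auto
    then have kk: "real (k * k) \<le> real n" by (simp add: power2_eq_square)
    then have kk': "k * k \<le> n" by (simp only: of_nat_le_iff)
    have "(sqrt (real n))\<^sup>2 < (real k + 1)\<^sup>2" using k by (intro power_strict_mono) auto
    then have "real n < real (k * k + 2 * k + 1)" by (simp add: power2_eq_square algebra_simps)
    then have n_less: "n < k * k + 2 * k + 1" by (simp only: of_nat_less_iff)
    define r where "r = n - k * k"
    have n_eq: "n = k * k + r" and r: "r \<le> 2 * k" using kk' n_less by (auto simp: r_def)
    have "g = ?m (rect k k) (rect r 1)"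
      by (rule heis_eqI) (simp_all add: g horizontal_rect height_rect n_eq)
    then have "wl g \<le> wl (rect k k) + wl (rect r 1)" using word_length_mult_le by simp
    also have "\<dots> \<le> (k + k) * c + (r + 1) * c" by (intro add_mono wl_rect)
    also have "\<dots> \<le> (4 * k + 1) * c" unfolding add_mult_distrib[symmetric] using r by (intro mult_right_mono) auto
    finally have "real (wl g) \<le> real ((4 * k + 1) * c)" by (simp only: of_nat_le_iff)
    also have "\<dots> = (4 * real k + 1) * real c" by (simp add: algebra_simps)
    also have "\<dots> \<le> (5 * sqrt (real n)) * real c"
    proof (rule mult_right_mono)
      show "4 * real k + 1 \<le> 5 * sqrt (real n)" using k(1) s1 by linarith
    qed simp
    also have "\<dots> = 5 * real c * sqrt (real n)" by simp
    also have "\<dots> \<le> (5 * real c + 1) * sqrt (real n)" by (intro mult_right_mono) auto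
    finally show ?thesis .
  qed
  then show ?thesis by (intro exI[of _ "5 * real c + 1"]) auto
qed

text \<open>The letters of a word contribute their own heights on top of the area of the planar path. This
  contribution does not depend on their order.\<close>

lemma vertical_bound:
  "\<exists>H\<ge>0. \<forall>ws. set ws \<subseteq> S \<longrightarrow> \<bar>sum_list (map height ws)\<bar> \<le> H * real (length ws)"
proof -
  define H where "H = Max (insert 0 ((\<lambda>s. \<bar>height s\<bar>) ` S))"
  have H: "\<bar>height s\<bar> \<le> H" if "s \<in> S" for s unfolding H_def using that finite_S by (intro Max_ge) auto
  have "H \<ge> 0" unfolding H_def using finite_S by (intro Max_ge) auto
  moreover have "\<bar>sum_list (map height ws)\<bar> \<le> H * real (length ws)" if "set ws \<subseteq> S" for ws
    using that
  proof (induction ws)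
    case (Cons s ws)
    then have "\<bar>height s\<bar> \<le> H" "\<bar>sum_list (map height ws)\<bar> \<le> H * real (length ws)" using H by auto
    then show ?case by (simp add: algebra_simps)
  qed simp
  ultimately show ?thesis by blast
qed

text \<open>There are only finitely many central elements of bounded height, as heights are integers.\<close>

lemma word_length_bounded_height:
  "\<exists>M. \<forall>k. horizontal k = 0 \<longrightarrow> \<bar>height k\<bar> \<le> B \<longrightarrow> wl k \<le> M"
proof -
  let ?A = "{k. horizontal k = 0 \<and> \<bar>height k\<bar> \<le> B}"
  have "height ` ?A \<subseteq> {x \<in> \<int>. \<bar>x\<bar> \<le> B}" using height_Ints by auto
  then have "finite (height ` ?A)" using finite_abs_int_segment by (rule finite_subset)
  moreover have "inj_on height ?A" by (rule inj_onI) (auto intro: heis_eqI)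
  ultimately have "finite ?A" by (rule finite_imageD)
  then have "wl k \<le> Max (wl ` ?A)" if "k \<in> ?A" for k using that by (intro Max_ge) auto
  then show ?thesis by blast
qed

section \<open>Central elements are almost dead ends\<close>

text \<open>Start from a geodesic word for \<open>g\<close>, boost the area of its projection \<open>w\<close> (path \<open>w1\<close>), move the endpoint
  to that of \<open>h\<close> (path \<open>w2\<close>), and rearrange the steps until the area is almost right (path \<open>w3\<close>). Any
  lift of \<open>w3\<close> to a word in \<open>S\<close> represents \<open>g h\<close> up to a central element \<open>k\<close> of bounded height. The
  target area \<open>\<tau>\<close> takes the heights of the lifted letters into account.\<close>

lemma almost_dead_end:
  "\<exists>M D0::real. M > 0 \<and> D0 > 0 \<and> (\<forall>D n g h. D \<ge> D0 \<longrightarrow> real n \<ge> D ^ 4 \<longrightarrow>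
     horizontal g = 0 \<longrightarrow> height g = 2 * real n \<longrightarrow> real (wl h) \<le> D \<longrightarrow>
     real (wl (g \<otimes>\<^bsub>H3\<^esub> h)) \<le> real (wl g) + M)"
proof -
  let ?P = "horizontal ` S" and ?radius = "steps.radius"
  obtain K1 :: real where K1: "K1 \<ge> 1" and central: "\<And>g n. n \<ge> 1 \<Longrightarrow> horizontal g = 0 \<Longrightarrow> height g = 2 * real n \<Longrightarrow>
      real (wl g) \<le> K1 * sqrt (real n)"
    using word_length_central_le by blast
  obtain H :: real where H: "H \<ge> 0" and vert: "\<And>ws. set ws \<subseteq> S \<Longrightarrow> \<bar>sum_list (map height ws)\<bar> \<le> H * real (length ws)"
    using vertical_bound by blast
  define K2 where "K2 = H + 2 * ?radius\<^sup>2 + 1"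
  have K2: "K2 \<ge> 1" using H by (simp add: K2_def)
  define B where "B = ?radius\<^sup>2 * K2"
  have "B \<ge> 0" using K2 by (simp add: B_def)
  then obtain Km L0 :: real where Km: "Km \<ge> 0" and move: "\<And>w v. set w \<subseteq> ?P \<Longrightarrow> sum_list w = 0 \<Longrightarrow>
      L0 \<le> real (length w) \<Longrightarrow> v \<in> integer_points \<Longrightarrow> (norm v)\<^sup>2 \<le> B * length w \<Longrightarrow> 0 \<le> area w \<Longrightarrow>
      (\<exists>w'. set w' \<subseteq> ?P \<and> sum_list w' = v \<and> length w' \<le> length w + Km \<and> area w' \<ge> area w - Km * length w)"
    using steps.move_endpoint by blast
  obtain \<kappa> :: real where \<kappa>: "\<kappa> > 0" and boost: "\<And>w j. set w \<subseteq> ?P \<Longrightarrow> sum_list w = 0 \<Longrightarrow>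
      (\<exists>w'. set w' \<subseteq> ?P \<and> sum_list w' = 0 \<and> length w' = length w + 2 * j \<and>
      real (length w) * area w' \<ge> (real (length w) + \<kappa> * real j) * area w)"
    using steps.boost_area by blast
  obtain M2 :: nat where M2: "\<And>k. horizontal k = 0 \<Longrightarrow> \<bar>height k\<bar> \<le> 4 * ?radius\<^sup>2 \<Longrightarrow> wl k \<le> M2"
    using word_length_bounded_height by blast
  define K3 where "K3 = K2\<^sup>2 + H * (2 + Km)"
  have K3: "K3 \<ge> 0" using H Km by (simp add: K3_def)
  \<comment> \<open>The boost has to outweigh the loss in \<open>move_endpoint\<close> on a path of length at most \<open>2 L\<close>, the height
      of \<open>h\<close>, and the heights of the letters before and after, all of which are multiples of \<open>L\<close>.\<close>
  obtain j :: nat where "(2 * Km + K3 + H) * K1\<^sup>2 / \<kappa> < real j" using reals_Archimedean2 by blast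
  then have j: "2 * Km + K3 + H \<le> \<kappa> * real j / K1\<^sup>2" using \<kappa> K1 by (simp add: field_simps)
  define M where "M = 2 * real j + Km + real M2 + 1"
  \<comment> \<open>The summands of \<open>D0\<close> make \<open>\<surd>n \<ge> D\<^sup>2 \<ge> D0\<close> large enough for the heights of letters to be at most \<open>n\<close>
      and for the path to be longer than \<open>L0\<close> and \<open>2 j\<close>.\<close>
  define D0 where "D0 = 1 + H * K1 + K3 * K1 + K2 * \<bar>L0\<bar> + K2 * (2 * real j)"
  have M0: "M > 0" using Km by (simp add: M_def)
  have terms: "H * K1 \<ge> 0" "K3 * K1 \<ge> 0" "K2 * \<bar>L0\<bar> \<ge> 0" "K2 * (2 * real j) \<ge> 0"
    using H K1 K2 K3 by auto
  then have D01: "D0 \<ge> 1" by (simp add: D0_def)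
  have main: "real (wl (g \<otimes>\<^bsub>H3\<^esub> h)) \<le> real (wl g) + M"
    if D: "D \<ge> D0" and nD: "real n \<ge> D ^ 4" and g: "horizontal g = 0" "height g = 2 * real n"
      and h: "real (wl h) \<le> D" for D n g h
  proof -
    define N s L where "N = real n" and "s = sqrt (real n)" and "L = real (wl g)"
    have sN: "s * s = N" by (simp add: s_def N_def)
    have D1: "D \<ge> 1" using D D01 by linarith
    have s_D2: "s \<ge> D\<^sup>2" unfolding s_def using nD by (intro real_le_rsqrt) simp
    have "D * 1 \<le> D * D" using D1 by (intro mult_left_mono) auto
    then have s_D0: "s \<ge> D0" using s_D2 D by (simp add: power2_eq_square)
    then have s0: "s \<ge> 1" using D01 by linarith
    have "N \<ge> 1" using mult_mono[OF s0 s0] s0 sN by simp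
    then have n1: "n \<ge> 1" by (simp add: N_def)
    have L_le: "L \<le> K1 * s" unfolding L_def s_def using central n1 g by blast
    have s_large: "s \<ge> H * K1" "s \<ge> K3 * K1" "s \<ge> K2 * L0" "s \<ge> K2 * (2 * real j)"
    proof -
      have "K2 * L0 \<le> K2 * \<bar>L0\<bar>" using K2 by (intro mult_left_mono) auto
      then show "s \<ge> H * K1" "s \<ge> K3 * K1" "s \<ge> K2 * L0" "s \<ge> K2 * (2 * real j)"
        using s_D0 terms unfolding D0_def by linarith+
    qed
    have small: "c * L \<le> N" if "c \<ge> 0" "c * K1 \<le> s" for c
    proof -
      have "c * L \<le> (c * K1) * s" using L_le that(1) by (simp add: mult.assoc mult_left_mono)
      also have "\<dots> \<le> s * s" using that(2) s0 by (intro mult_right_mono) auto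
      finally show ?thesis using sN by simp
    qed
    obtain ws where ws: "set ws \<subseteq> S" "length ws = wl g" "ev ws = g" using geodesic by blast
    define w where "w = map horizontal ws"
    have w: "set w \<subseteq> ?P" "sum_list w = 0" "real (length w) = L"
      using ws g(1) horizontal_ev[of ws] by (auto simp: w_def L_def)
    have area_w: "2 * N = sum_list (map height ws) + area w"
      using height_ev[of ws] ws(3) g(2) by (simp add: w_def N_def)
    have vert_w: "\<bar>sum_list (map height ws)\<bar> \<le> H * L" using vert[OF ws(1)] ws(2) by (simp add: L_def)
    have "ws \<noteq> []" using ws(3) g(2) n1 by auto
    then have L1: "L \<ge> 1" using ws(2) by (simp add: L_def Suc_le_eq flip: ws(2))
    have area_w_ge: "area w \<ge> 2 * N - H * L" using area_w vert_w by linarith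
    have area_w_N: "area w \<ge> N" using area_w_ge small[OF H s_large(1)] by linarith
    have s_L: "s \<le> K2 * L"
    proof -
      have "\<bar>area w\<bar> \<le> 2 * ?radius\<^sup>2 * L\<^sup>2" using steps.area_word_le[OF w(1)] w(3) by simp
      then have "2 * N \<le> H * L + 2 * ?radius\<^sup>2 * L\<^sup>2" using area_w vert_w by linarith
      also have "H * L \<le> H * L\<^sup>2" using L1 H by (intro mult_left_mono) (auto simp: power2_eq_square)
      finally have "2 * N \<le> (H + 2 * ?radius\<^sup>2) * L\<^sup>2" by (simp add: algebra_simps)
      also have "\<dots> \<le> K2\<^sup>2 * L\<^sup>2"
      proof (rule mult_right_mono)
        have "K2 * 1 \<le> K2 * K2" using K2 by (intro mult_left_mono) auto
        then show "H + 2 * ?radius\<^sup>2 \<le> K2\<^sup>2" by (simp add: power2_eq_square[of K2]) (simp add: K2_def)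
      qed simp
      finally have "s\<^sup>2 \<le> (K2 * L)\<^sup>2"
        unfolding power_mult_distrib power2_eq_square[of s] sN using \<open>N \<ge> 1\<close> by linarith
      moreover have "0 \<le> K2 * L" using K2 L1 by simp
      ultimately show ?thesis by (rule power2_le_imp_le)
    qed
    have L_large: "L \<ge> L0" "L \<ge> 2 * real j"
    proof -
      have "K2 * L0 \<le> K2 * L" "K2 * (2 * real j) \<le> K2 * L" using s_L s_large by linarith+
      then show "L \<ge> L0" "L \<ge> 2 * real j" using K2 by simp_all
    qed
    have L2: "L\<^sup>2 \<le> K1\<^sup>2 * area w"
    proof -
      have "L\<^sup>2 \<le> (K1 * s)\<^sup>2" using L_le L1 by (intro power_mono) auto
      also have "\<dots> = K1\<^sup>2 * N" by (simp add: power_mult_distrib power2_eq_square[of s] sN)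
      also have "\<dots> \<le> K1\<^sup>2 * area w" using area_w_N by (intro mult_left_mono) auto
      finally show ?thesis .
    qed
    obtain hs where hs: "set hs \<subseteq> S" "length hs = wl h" "ev hs = h" using geodesic by blast
    have hs_P: "set (map horizontal hs) \<subseteq> ?P" using hs(1) by auto
    have "norm (horizontal h) \<le> ?radius * D"
    proof -
      have "norm (horizontal h) \<le> ?radius * real (wl h)"
        using steps.norm_word_le[OF hs_P] hs horizontal_ev[of hs] by simp
      also have "\<dots> \<le> ?radius * D" using h steps.radius_nonneg by (rule mult_left_mono)
      finally show ?thesis .
    qed
    then have "(norm (horizontal h))\<^sup>2 \<le> (?radius * D)\<^sup>2" by (intro power_mono) auto
    also have "\<dots> = ?radius\<^sup>2 * D\<^sup>2" by (simp add: power_mult_distrib)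
    also have "\<dots> \<le> ?radius\<^sup>2 * (K2 * L)" using s_D2 s_L by (intro mult_left_mono) auto
    finally have horizontal_h: "(norm (horizontal h))\<^sup>2 \<le> B * L" by (simp add: B_def mult.assoc)
    have height_h: "\<bar>height h\<bar> \<le> K2\<^sup>2 * L"
    proof -
      have "\<bar>area (map horizontal hs)\<bar> \<le> 2 * ?radius\<^sup>2 * (real (wl h))\<^sup>2"
        using steps.area_word_le[OF hs_P] hs(2) by simp
      also have "\<dots> \<le> 2 * ?radius\<^sup>2 * D\<^sup>2" using h by (intro mult_left_mono power_mono) auto
      finally have 1: "\<bar>area (map horizontal hs)\<bar> \<le> 2 * ?radius\<^sup>2 * D\<^sup>2" .
      have "\<bar>sum_list (map height hs)\<bar> \<le> H * real (wl h)" using vert[OF hs(1)] hs(2) by simp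
      also have "\<dots> \<le> H * D\<^sup>2"
      proof (rule mult_left_mono[OF _ H])
        have "D * 1 \<le> D * D" using D1 by (intro mult_left_mono) auto
        then show "real (wl h) \<le> D\<^sup>2" using h by (simp add: power2_eq_square)
      qed
      finally have "\<bar>height h\<bar> \<le> H * D\<^sup>2 + 2 * ?radius\<^sup>2 * D\<^sup>2"
        using 1 height_ev[of hs] unfolding hs(3) by linarith
      also have "\<dots> \<le> K2 * D\<^sup>2" by (simp add: K2_def algebra_simps)
      also have "\<dots> \<le> K2 * (K2 * L)" using K2 s_D2 s_L by (intro mult_left_mono) auto
      finally show ?thesis by (simp add: power2_eq_square mult.assoc)
    qed
    obtain w1 where w1: "set w1 \<subseteq> ?P" "sum_list w1 = 0" "length w1 = length w + 2 * j"
      "L * area w1 \<ge> (L + \<kappa> * real j) * area w"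
      using boost[OF w(1,2), of j] w(3) by auto
    have area_w1: "area w1 \<ge> area w + (2 * Km + K3 + H) * L"
    proof -
      have "(2 * Km + K3 + H) * L\<^sup>2 \<le> (\<kappa> * real j / K1\<^sup>2) * L\<^sup>2" using j by (intro mult_right_mono) auto
      also have "\<dots> \<le> (\<kappa> * real j / K1\<^sup>2) * (K1\<^sup>2 * area w)"
        using L2 \<kappa> by (intro mult_left_mono) auto
      also have "\<dots> = \<kappa> * real j * area w" using K1 by simp
      finally have "L * area w1 \<ge> L * (area w + (2 * Km + K3 + H) * L)"
        using w1(4) by (simp add: algebra_simps power2_eq_square)
      then show ?thesis using L1 by (simp add: mult_le_cancel_left)
    qed
    define L1' where "L1' = real (length w1)"
    have L1': "L \<le> L1'" "L1' = L + 2 * real j" "L1' \<le> 2 * L"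
      using w1(3) w(3) L_large by (auto simp: L1'_def)
    have "area w1 \<ge> 0"
    proof -
      have "(2 * Km + K3 + H) * L \<ge> 0" using Km K3 H L1 by (intro mult_nonneg_nonneg) auto
      then show ?thesis using area_w1 area_w_N \<open>N \<ge> 1\<close> by linarith
    qed
    moreover have "(norm (horizontal h))\<^sup>2 \<le> B * L1'"
      using horizontal_h mult_left_mono[OF L1'(1) \<open>B \<ge> 0\<close>] by linarith
    moreover have "L0 \<le> L1'" using L_large L1' by linarith
    ultimately obtain w2 where w2: "set w2 \<subseteq> ?P" "sum_list w2 = horizontal h" "length w2 \<le> L1' + Km"
      "area w2 \<ge> area w1 - Km * L1'"
      using move[OF w1(1,2) _ horizontal_integer, of h] unfolding L1'_def by auto
    have area_w2: "area w2 \<ge> 2 * N + K3 * L"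
    proof -
      have "Km * L1' \<le> Km * (2 * L)" using L1' Km by (intro mult_left_mono) auto
      then show ?thesis using w2(4) area_w1 area_w_ge by (simp add: algebra_simps)
    qed
    define lift where "lift = inv_into S horizontal"
    have lift: "lift p \<in> S" "horizontal (lift p) = p" if "p \<in> ?P" for p
      using that by (auto simp: lift_def inv_into_into f_inv_into_f)
    define V where "V = sum_list (map height (map lift w2))"
    have V: "\<bar>V\<bar> \<le> H * (2 + Km) * L"
    proof -
      have "set (map lift w2) \<subseteq> S" using w2(1) lift(1) by auto
      then have "\<bar>V\<bar> \<le> H * real (length w2)" unfolding V_def using vert[of "map lift w2"] by simp
      also have "\<dots> \<le> H * (2 * L + Km * L)"
      proof (rule mult_left_mono[OF _ H])
        have "Km * 1 \<le> Km * L" using Km L1 by (intro mult_left_mono) auto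
        then show "real (length w2) \<le> 2 * L + Km * L" using w2(3) L1'(3) by linarith
      qed
      finally show ?thesis by (simp add: algebra_simps)
    qed
    define \<tau> where "\<tau> = 2 * N + height h - V"
    have K3L: "K3 * L = K2\<^sup>2 * L + H * (2 + Km) * L" by (simp add: K3_def algebra_simps)
    have "\<tau> \<le> area w2" using area_w2 height_h V K3L unfolding \<tau>_def by linarith
    moreover have "- area w2 \<le> \<tau>"
      using small[OF K3 s_large(2)] area_w2 height_h V K3L \<open>N \<ge> 1\<close> unfolding \<tau>_def by linarith
    ultimately obtain w3 where w3: "mset w3 = mset w2" "\<bar>area w3 - \<tau>\<bar> \<le> 4 * ?radius\<^sup>2"
      using steps.area_interpolation[OF w2(1)] by blast
    have w3_P: "set w3 \<subseteq> ?P" using w2(1) mset_eq_setD[OF w3(1)] by simp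
    define us where "us = map lift w3"
    have us: "set us \<subseteq> S" using w3_P lift(1) by (auto simp: us_def)
    have map_us: "map horizontal us = w3" unfolding us_def map_map
    proof (rule map_idI)
      fix p assume "p \<in> set w3"
      then have "p \<in> ?P" using w3_P by blast
      then show "(horizontal \<circ> lift) p = p" using lift(2) by simp
    qed
    have "horizontal (ev us) = horizontal h"
    proof -
      have "sum_list w3 = sum_list w2" using w3(1) by (metis sum_mset_sum_list)
      then show ?thesis by (simp add: horizontal_ev map_us w2(2))
    qed
    have "sum_list (map height us) = V"
    proof -
      have "mset (map height us) = mset (map height (map lift w2))" using w3(1) by (simp add: us_def)
      then show ?thesis unfolding V_def by (metis sum_mset_sum_list)
    qed
    then have height_us: "height (ev us) = V + area w3" by (simp add: height_ev map_us)
    define k where "k = inv\<^bsub>H3\<^esub> (ev us) \<otimes>\<^bsub>H3\<^esub> (g \<otimes>\<^bsub>H3\<^esub> h)"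
    have "horizontal k = 0" by (simp add: k_def g(1) \<open>horizontal (ev us) = horizontal h\<close>)
    moreover have "\<bar>height k\<bar> \<le> 4 * ?radius\<^sup>2"
    proof -
      have "height k = \<tau> - area w3"
        by (simp add: k_def g \<open>horizontal (ev us) = horizontal h\<close> height_us \<tau>_def N_def)
      then show ?thesis using w3(2) by linarith
    qed
    ultimately have wl_k: "wl k \<le> M2" by (rule M2)
    have "g \<otimes>\<^bsub>H3\<^esub> h = ev us \<otimes>\<^bsub>H3\<^esub> k" by (simp add: k_def H3.m_assoc[symmetric])
    then have "wl (g \<otimes>\<^bsub>H3\<^esub> h) \<le> wl (ev us) + wl k" using word_length_mult_le by simp
    also have "\<dots> \<le> length us + M2" using word_length_ev_le[OF us] wl_k by (rule add_mono)
    finally have "real (wl (g \<otimes>\<^bsub>H3\<^esub> h)) \<le> real (length us) + real M2" by linarith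
    also have "length us = length w2" using mset_eq_length[OF w3(1)] by (simp add: us_def)
    finally show ?thesis using w2(3) L1'(2) by (simp add: M_def L_def)
  qed
  show ?thesis
    by (rule exI[of _ M], rule exI[of _ D0], intro conjI allI impI)
       (use M0 D01 main in auto)
qed

end

theorem theorem2:
  fixes S :: "heis set"
  assumes "finite S"
    and "S \<subseteq> carrier H3"
    and "\<And>s. s \<in> S \<Longrightarrow> inv\<^bsub>H3\<^esub> s \<in> S"
    and "generate H3 S = carrier H3"
  shows "\<exists>C M D0 :: real. C > 0 \<and> M > 0 \<and> D0 > 0 \<and>
    (\<forall>D \<ge> D0. \<forall>n :: int. real_of_int n \<ge> C * D ^ 4 \<longrightarrow>
      (let g = commutator H3 heis_x heis_y [^]\<^bsub>H3\<^esub> n in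
        \<forall>h \<in> carrier H3. real (word_length H3 S h) \<le> D \<longrightarrow>
          real (word_length H3 S (g \<otimes>\<^bsub>H3\<^esub> h)) \<le> real (word_length H3 S g) + M))"
proof -
  interpret heis_generators S
    using assms by unfold_locales auto
  obtain M D0 :: real where M: "M > 0" and D0: "D0 > 0" and
    main: "\<And>D n g h. D \<ge> D0 \<Longrightarrow> real n \<ge> D ^ 4 \<Longrightarrow> horizontal g = 0 \<Longrightarrow> height g = 2 * real n \<Longrightarrow>
      real (wl h) \<le> D \<Longrightarrow> real (wl (g \<otimes>\<^bsub>H3\<^esub> h)) \<le> real (wl g) + M"
    using almost_dead_end by blast
  have "real (wl (g \<otimes>\<^bsub>H3\<^esub> h)) \<le> real (wl g) + M"
    if D: "D \<ge> D0" and n: "real_of_int n \<ge> 1 * D ^ 4" and g: "g = commutator H3 heis_x heis_y [^]\<^bsub>H3\<^esub> n"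
      and h: "real (wl h) \<le> D" for D n g h
  proof (rule main[OF D _ _ _ h])
    have "0 \<le> D ^ 4" by simp
    then have "0 \<le> real_of_int n" using n by linarith
    then have n0: "real (nat n) = real_of_int n" by simp
    show "real (nat n) \<ge> D ^ 4" using n n0 by simp
    show "horizontal g = 0" "height g = 2 * real (nat n)" unfolding n0 g heis_z_def[symmetric] by simp_all
  qed
  then show ?thesis
    \<comment> \<open>The constants \<open>M\<close> and \<open>D0\<close> absorb any choice of \<open>C\<close>.\<close>
    using M D0 by (intro exI[of _ 1] exI[of _ M] exI[of _ D0]) (auto simp: Let_def)
qed

end
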